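(* Let $n\ge4$, $i=n-1$, $m\ge1$ and $A=(a_{p,q})\in B^{i,m}$. Define $\Omega_1:=-a_{1,n-1}$, $\nu_1:=1$, and for $2\le k\le n-1$ recursively $\Omega_k:=a_{k-1,n}+(1-\nu_{k-1})\Omega_{k-1}-a_{k,n-1}$, $\nu_k:=1$ if $\Omega_k<0$ and $\nu_k:=0$ if $\Omega_k\ge0$. For $1\le\ell\le n-1$ let $b_\ell=a_{\ell,n-1}+a_{\ell,n}$ and $$Y_\ell:=\big(f_\ell^{b_\ell}\circ f_{\ell+1}^{b_\ell}\circ\cdots\circ f_{n-2}^{b_\ell}\big)\circ f_{n-1}^{a_{\ell,n-1}}$$ (the first composition being the identity if $\ell=n-1$), and with $S=\sum_{p=1}^{n-1}a_{p,n}$ let $H:=f_n^{S}\circ f_{n-1}^{S}$. For $1\le k\le n-1$ let $$T^{(k)}:=Y_k\circ Y_{k-1}\circ\cdots\circ Y_1\circ H\,(T^{(0)})\in\mathrm{SSYT}(m\omega_i),$$ the operators acting on tableaux, and for $1\le s\le i$ write $T^{(k)}_s=(T^{(k)}_{s,1},T^{(k)}_{s,2},T^{(k)}_{s,3})$ in matrix notation. Then these tableaux are defined and: - for $1\le s\le k-1$: $T^{(k)}_s=\Big(m-\sum_{j=1}^s(a_{j,n}-\nu_j\Omega_j),\ -\sum_{j=1}^s\nu_j\Omega_j+(1-\nu_{s+1})\Omega_{s+1},\ \sum_{j=2}^{s+1}(a_{j,n-1}+\nu_j\Omega_j)\Big)$; - for $k\le s\le i-1$: $T^{(k)}_s=\Big(m-\sum_{j=1}^k(a_{j,n}-\nu_j\Omega_j),\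 -\sum_{j=1}^k\nu_j\Omega_j+a_{k,n}+(1-\nu_k)\Omega_k,\ \sum_{j=2}^{k}(a_{j,n-1}+\nu_j\Omega_j)\Big)$; - for $s=i$: $T^{(k)}_s=\Big(m-\sum_{j=1}^i a_{j,n}+\sum_{j=1}^k\nu_j\Omega_j,\ -\sum_{j=1}^k\nu_j\Omega_j,\ \sum_{j=1}^i a_{j,n}\Big)$. In particular $\varphi_{i,m}(A)=T^{(n-1)}$.
   Context: $B^{i,m}$ is the set of arrays $A=(a_{p,q})$ of non-negative integers indexed by $1\le p\le i$ (column index), $i\le q\le n$ (row index), with $\sum_{r=1}^n a_{\beta(r)}\le m$ for every Dyck path $\beta$ (positions $\beta(1)=(1,i),\dots,\beta(n)=(i,n)$ with $\beta(r+1)\in\{(a,b+1),(a+1,b)\}$ if $\beta(r)=(a,b)$); $a_{p,q}=0$ outside this range. It carries a crystal structure (Kus's polytope model of the Kirillov–Reshetikhin crystal; the zero array is its highest weight element). $\mathrm{SSYT}(m\omega_i)$: semistandard Young tableaux of rectangular shape with $i$ rows and $m$ columns, entries in $\{1,\dots,n+1\}$; row $s$ has entries in $[s,n-i+s+1]$ (so for $i=n-1$, in $\{s,s+1,s+2\}$). Crystal operators on tableaux, $1\le j\le n$: read the tableau left to right along rows, starting with the bottom row and moving up; ignoring letters other than $j,j+1$, repeatedly cancel a letter $j+1$ immediately followed by a letter $j$ until the remaining letters are $j^a(j+1)^b$; $f_j$ changes the rightmost unpaired $j$ to $j+1$ (undefined if $a=0$), $e_j$ changes the leftmost unpaired $j+1$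 to $j$. $f_j^c$ means $c$-fold application, $\circ$ is applied right to left. $T^{(0)}$ is the tableau whose row $s$ has all entries $s$. Matrix notation: $T_{s,t}$ is the number of entries equal to $s+t-1$ in row $s$ of $T$. $\varphi_{i,m}:B^{i,m}\to\mathrm{SSYT}(m\omega_i)$ is the crystal isomorphism (the unique bijection commuting with all $f_j,e_j$, $1\le j\le n$; it also respects the affine crystal structures), sending the zero array to $T^{(0)}$. *)

theory Defs
  imports Main
begin

text \<open>Arrays are indexed as \<open>A p q\<close> (column \<open>p\<close>, row \<open>q\<close>); tableaux as \<open>T s c\<close> (row \<open>s\<close>, column
  \<open>c\<close>, both counted from 1). Both vanish outside their range, so that equality of functions is
  equality of arrays or tableaux.\<close>

type_synonym array = "nat \<Rightarrow> nat \<Rightarrow> nat"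
type_synonym tableau = "nat \<Rightarrow> nat \<Rightarrow> nat"

section \<open>The polytope model\<close>

definition dyck_path :: "nat \<Rightarrow> nat \<Rightarrow> (nat \<Rightarrow> nat \<times> nat) \<Rightarrow> bool" where
  "dyck_path n i \<beta> \<longleftrightarrow> \<beta> 1 = (1, i) \<and> \<beta> n = (i, n) \<and>
     (\<forall>r\<in>{1..<n}. \<beta> (r + 1) \<in> {(fst (\<beta> r), snd (\<beta> r) + 1), (fst (\<beta> r) + 1, snd (\<beta> r))})"

definition kus_arrays :: "nat \<Rightarrow> nat \<Rightarrow> nat \<Rightarrow> array set" where
  "kus_arrays n i m = {A.
     (\<forall>p q. \<not> (1 \<le> p \<and> p \<le> i \<and> i \<le> q \<and> q \<le> n) \<longrightarrow> A p q = 0) \<and>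
     (\<forall>\<beta>. dyck_path n i \<beta> \<longrightarrow> (\<Sum>r=1..n. A (fst (\<beta> r)) (snd (\<beta> r))) \<le> m)}"

definition zero_array :: array where
  "zero_array = (\<lambda>p q. 0)"

text \<open>Kus's crystal operators (Kus, \emph{Realization of affine type A Kirillov--Reshetikhin
  crystals via polytopes}). For \<open>l \<noteq> i\<close> the operators move one unit between two neighbouring columns
  (\<open>l < i\<close>) or rows (\<open>l > i\<close>). The place is an extremal maximiser of the sum over the part
  of a Dyck path that lies in these two columns or rows and switches between them at \<open>p\<close>.\<close>

definition kus_place :: "nat \<Rightarrow> nat \<Rightarrow> nat \<Rightarrow> array \<Rightarrow> nat set" where
  "kus_place n i l A =
    (if l < i then
       (let S = (\<lambda>p. (\<Sum>j=i..p. A l j) + (\<Sum>j=p..n. A (l + 1) j))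
        in {p \<in> {i..n}. S p = Max (S ` {i..n})})
     else
       (let S = (\<lambda>p. (\<Sum>j=1..p. A j (l - 1)) + (\<Sum>j=p..i. A j l))
        in {p \<in> {1..i}. S p = Max (S ` {1..i})}))"

definition kus_f_place :: "nat \<Rightarrow> nat \<Rightarrow> nat \<Rightarrow> array \<Rightarrow> nat" where
  "kus_f_place n i l A =
    (if l < i then Max (kus_place n i l A) else Min (kus_place n i l A))"

definition kus_e_place :: "nat \<Rightarrow> nat \<Rightarrow> nat \<Rightarrow> array \<Rightarrow> nat" where
  "kus_e_place n i l A =
    (if l < i then Min (kus_place n i l A) else Max (kus_place n i l A))"

definition kus_phi :: "nat \<Rightarrow> nat \<Rightarrow> nat \<Rightarrow> nat \<Rightarrow> array \<Rightarrow> int" where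
  "kus_phi n i m l A = (let p = kus_f_place n i l A in
     if l = i then int m - (\<Sum>j=1..<i. int (A j i)) - (\<Sum>j=i..n. int (A i j))
     else if l < i then (\<Sum>j=p..n. int (A (l + 1) j)) - (\<Sum>j=p+1..n. int (A l j))
     else (\<Sum>j=1..p. int (A j (l - 1))) - (\<Sum>j=1..<p. int (A j l)))"

definition kus_eps :: "nat \<Rightarrow> nat \<Rightarrow> nat \<Rightarrow> array \<Rightarrow> int" where
  "kus_eps n i l A = (let p = kus_e_place n i l A in
     if l = i then int (A i i)
     else if l < i then (\<Sum>j=i..p. int (A l j)) - (\<Sum>j=i..<p. int (A (l + 1) j))
     else (\<Sum>j=p..i. int (A j l)) - (\<Sum>j=p+1..i. int (A j (l - 1))))"

definition set_entry :: "nat \<Rightarrow> nat \<Rightarrow> nat \<Rightarrow> (nat \<Rightarrow> nat \<Rightarrow> nat) \<Rightarrow> nat \<Rightarrow> nat \<Rightarrow> nat" where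
  "set_entry a b x A = A(a := (A a)(b := x))"

definition kus_f :: "nat \<Rightarrow> nat \<Rightarrow> nat \<Rightarrow> nat \<Rightarrow> array \<Rightarrow> array option" where
  "kus_f n i m l A = (let p = kus_f_place n i l A in
     if kus_phi n i m l A \<le> 0 then None
     else if l = i then Some (set_entry i i (A i i + 1) A)
     else if l < i then
       Some (set_entry l p (A l p + 1) (set_entry (l + 1) p (A (l + 1) p - 1) A))
     else
       Some (set_entry p l (A p l + 1) (set_entry p (l - 1) (A p (l - 1) - 1) A)))"

definition kus_e :: "nat \<Rightarrow> nat \<Rightarrow> nat \<Rightarrow> array \<Rightarrow> array option" where
  "kus_e n i l A = (let p = kus_e_place n i l A in
     if kus_eps n i l A \<le> 0 then None
     else if l = i then Some (set_entry i i (A i i - 1) A)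
     else if l < i then
       Some (set_entry l p (A l p - 1) (set_entry (l + 1) p (A (l + 1) p + 1) A))
     else
       Some (set_entry p l (A p l - 1) (set_entry p (l - 1) (A p (l - 1) + 1) A)))"

section \<open>The tableau model\<close>

definition ssyt :: "nat \<Rightarrow> nat \<Rightarrow> nat \<Rightarrow> tableau set" where
  "ssyt n i m = {T.
     (\<forall>s c. \<not> (1 \<le> s \<and> s \<le> i \<and> 1 \<le> c \<and> c \<le> m) \<longrightarrow> T s c = 0) \<and>
     (\<forall>s\<in>{1..i}. \<forall>c\<in>{1..m}. T s c \<in> {1..n + 1}) \<and>
     (\<forall>s\<in>{1..i}. \<forall>c\<in>{1..<m}. T s c \<le> T s (c + 1)) \<and>
     (\<forall>s\<in>{1..<i}. \<forall>c\<in>{1..m}. T s c < T (s + 1) c)}"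

definition highest_tableau :: "nat \<Rightarrow> nat \<Rightarrow> tableau" where
  "highest_tableau i m = (\<lambda>s c. if 1 \<le> s \<and> s \<le> i \<and> 1 \<le> c \<and> c \<le> m then s else 0)"

definition tab_matrix :: "nat \<Rightarrow> tableau \<Rightarrow> nat \<Rightarrow> nat \<Rightarrow> nat" where
  "tab_matrix m T s t = card {c \<in> {1..m}. T s c = s + t - 1}"

text \<open>The reading word, every letter paired with the cell it comes from.\<close>

definition reading_word :: "nat \<Rightarrow> nat \<Rightarrow> tableau \<Rightarrow> ((nat \<times> nat) \<times> nat) list" where
  "reading_word i m T =
     concat (map (\<lambda>s. map (\<lambda>c. ((s, c), T s c)) [1..<m + 1]) (rev [1..<i + 1]))"

text \<open>The unpaired letters of a word, computed from right to left. The lemmas \<open>unpaired_steps\<close> and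
  \<open>unpaired_form\<close> state that they result from repeated cancellation and have the form
  \<open>j\<^sup>a (j+1)\<^sup>b\<close>.\<close>

fun unpaired :: "nat \<Rightarrow> ('c \<times> nat) list \<Rightarrow> ('c \<times> nat) list" where
  "unpaired j [] = []"
| "unpaired j (x # xs) =
     (if snd x \<noteq> j \<and> snd x \<noteq> j + 1 then unpaired j xs
      else (case unpaired j xs of
          [] \<Rightarrow> [x]
        | y # ys \<Rightarrow> if snd x = j + 1 \<and> snd y = j then ys else x # y # ys))"

inductive cancel_step :: "nat \<Rightarrow> ('c \<times> nat) list \<Rightarrow> ('c \<times> nat) list \<Rightarrow> bool" for j where
  "snd x = j + 1 \<Longrightarrow> snd y = j \<Longrightarrow> cancel_step j (us @ x # y # vs) (us @ vs)"

lemma cancel_step_Cons: "cancel_step j xs ys \<Longrightarrow> cancel_step j (z # xs) (z # ys)"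
  by (erule cancel_step.cases) (metis append_Cons cancel_step.intros)

lemma cancel_steps_Cons:
  "(cancel_step j)\<^sup>*\<^sup>* xs ys \<Longrightarrow> (cancel_step j)\<^sup>*\<^sup>* (z # xs) (z # ys)"
  by (induction rule: rtranclp_induct) (auto intro: cancel_step_Cons rtranclp.rtrancl_into_rtrancl)

lemma unpaired_steps:
  "(cancel_step j)\<^sup>*\<^sup>* (filter (\<lambda>x. snd x = j \<or> snd x = j + 1) w) (unpaired j w)"
proof (induction w)
  case (Cons x w)
  let ?P = "\<lambda>x. snd x = j \<or> snd x = j + 1"
  show ?case
  proof (cases "?P x")
    case True
    have *: "(cancel_step j)\<^sup>*\<^sup>* (filter ?P (x # w)) (x # unpaired j w)"
      using cancel_steps_Cons[OF Cons.IH] True by auto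
    show ?thesis
    proof (cases "unpaired j w")
      case Nil
      then show ?thesis using * True by auto
    next
      case (Cons y ys)
      show ?thesis
      proof (cases "snd x = j + 1 \<and> snd y = j")
        case c: True
        have "cancel_step j (x # y # ys) ys"
          using cancel_step.intros[of x j y "[]" ys] c by simp
        then show ?thesis
          using * Cons c by (auto intro: rtranclp.rtrancl_into_rtrancl)
      next
        case False
        then show ?thesis using * Cons True by auto
      qed
    qed
  qed (use Cons.IH in auto)
qed simp

lemma unpaired_form:
  "\<exists>a b. map snd (unpaired j w) = replicate a j @ replicate b (j + 1)"
proof (induction w)
  case (Cons x w)
  then obtain a b where ab: "map snd (unpaired j w) = replicate a j @ replicate b (j + 1)"
    by blast
  show ?case
  proof (cases "unpaired j w")
    case Nil
    have "\<exists>a b. [j] = replicate a j @ replicate b (j + 1)"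
      by (rule exI[of _ 1], rule exI[of _ 0]) simp
    moreover have "\<exists>a b. [j + 1] = replicate a j @ replicate b (j + 1)"
      by (rule exI[of _ 0], rule exI[of _ 1]) simp
    ultimately show ?thesis using Nil Cons by auto
  next
    case c: (Cons y ys)
    show ?thesis
    proof (cases a)
      case 0
      then have "map snd (x # unpaired j w) = replicate 1 j @ replicate b (j + 1)" if "snd x = j"
        using ab that by simp
      moreover from 0
      have "map snd (x # unpaired j w) = replicate 0 j @ replicate (Suc b) (j + 1)"
        if "snd x = j + 1"
        using ab that by simp
      moreover have "snd y = j + 1" using 0 ab c by (cases b) auto
      ultimately have "snd x = j \<or> snd x = j + 1 \<Longrightarrow>
          \<exists>a b. map snd (x # unpaired j w) = replicate a j @ replicate b (j + 1)"
        by blast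
      then show ?thesis using c Cons \<open>snd y = j + 1\<close> by auto
    next
      case (Suc a')
      then have y: "snd y = j" "map snd ys = replicate a' j @ replicate b (j + 1)"
        using ab c by auto
      have "map snd (x # unpaired j w) = replicate (Suc a) j @ replicate b (j + 1)" if "snd x = j"
        using ab that by simp
      then have "snd x = j \<Longrightarrow>
          \<exists>a b. map snd (x # unpaired j w) = replicate a j @ replicate b (j + 1)"
        by blast
      then show ?thesis using c Cons y by auto
    qed
  qed
qed simp

definition tab_f :: "nat \<Rightarrow> nat \<Rightarrow> nat \<Rightarrow> tableau \<Rightarrow> tableau option" where
  "tab_f i m j T =
    (let us = filter (\<lambda>x. snd x = j) (unpaired j (reading_word i m T))
     in if us = [] then None
        else Some (set_entry (fst (fst (last us))) (snd (fst (last us))) (j + 1) T))"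

definition tab_e :: "nat \<Rightarrow> nat \<Rightarrow> nat \<Rightarrow> tableau \<Rightarrow> tableau option" where
  "tab_e i m j T =
    (let us = filter (\<lambda>x. snd x = j + 1) (unpaired j (reading_word i m T))
     in if us = [] then None
        else Some (set_entry (fst (fst (hd us))) (snd (fst (hd us))) j T))"

section \<open>The crystal isomorphism\<close>

text \<open>Since \<open>None\<close> stands for an undefined operator, commuting with \<open>f\<^sub>j\<close> and \<open>e\<^sub>j\<close> includes
  that both sides are defined for the same arguments. The conditions determine \<open>\<phi>\<close> on
  \<open>kus_arrays n i m\<close>; values elsewhere are irrelevant.\<close>

definition crystal_iso :: "nat \<Rightarrow> nat \<Rightarrow> nat \<Rightarrow> (array \<Rightarrow> tableau) \<Rightarrow> bool" where
  "crystal_iso n i m \<phi> \<longleftrightarrow>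
     bij_betw \<phi> (kus_arrays n i m) (ssyt n i m) \<and>
     (\<forall>A\<in>kus_arrays n i m. \<forall>j\<in>{1..n}.
        map_option \<phi> (kus_f n i m j A) = tab_f i m j (\<phi> A) \<and>
        map_option \<phi> (kus_e n i j A) = tab_e i m j (\<phi> A)) \<and>
     \<phi> zero_array = highest_tableau i m"

section \<open>The operators and parameters of the theorem\<close>

definition tab_f_pow ::
  "nat \<Rightarrow> nat \<Rightarrow> nat \<Rightarrow> nat \<Rightarrow> tableau option \<Rightarrow> tableau option" where
  "tab_f_pow i m j c = (\<lambda>x. Option.bind x (tab_f i m j)) ^^ c"

text \<open>Here \<open>i = n - 1\<close>. The values at index 0 are dummies.\<close>

fun Omega :: "nat \<Rightarrow> array \<Rightarrow> nat \<Rightarrow> int" and nu :: "nat \<Rightarrow> array \<Rightarrow> nat \<Rightarrow> int" where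
  "Omega n A 0 = 0"
| "Omega n A (Suc 0) = - int (A 1 (n - 1))"
| "Omega n A (Suc (Suc k)) =
     int (A (Suc k) n) + (1 - nu n A (Suc k)) * Omega n A (Suc k) - int (A (Suc (Suc k)) (n - 1))"
| "nu n A 0 = 0"
| "nu n A (Suc 0) = 1"
| "nu n A (Suc (Suc k)) = (if Omega n A (Suc (Suc k)) < 0 then 1 else 0)"

definition Y_op :: "nat \<Rightarrow> nat \<Rightarrow> array \<Rightarrow> nat \<Rightarrow> tableau option \<Rightarrow> tableau option" where
  "Y_op n m A l x =
     foldr (\<lambda>j. tab_f_pow (n - 1) m j (A l (n - 1) + A l n)) [l..<n - 1]
       (tab_f_pow (n - 1) m (n - 1) (A l (n - 1)) x)"

definition H_op :: "nat \<Rightarrow> nat \<Rightarrow> array \<Rightarrow> tableau option \<Rightarrow> tableau option" where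
  "H_op n m A x = (let S = (\<Sum>p=1..n - 1. A p n)
     in tab_f_pow (n - 1) m n S (tab_f_pow (n - 1) m (n - 1) S x))"

text \<open>\<open>T_tab n m A k\<close> is \<open>Y\<^sub>k \<circ> \<dots> \<circ> Y\<^sub>1 \<circ> H\<close> applied to the highest weight tableau.\<close>

definition T_tab :: "nat \<Rightarrow> nat \<Rightarrow> array \<Rightarrow> nat \<Rightarrow> tableau option" where
  "T_tab n m A k = fold (Y_op n m A) [1..<k + 1] (H_op n m A (Some (highest_tableau (n - 1) m)))"

end

theory Submission
  imports Defs
begin

text \<open>A tableau with entries in \<open>{s, s + 1, s + 2}\<close> in row \<open>s\<close> is determined by the numbers \<open>p s\<close>
  of letters \<open>s\<close> and \<open>q s\<close> of letters at most \<open>s + 1\<close>. Semistandardness cancels all but three blocks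
  of the signature for \<open>f\<^sub>j\<close>, which therefore lowers \<open>q (j - 1)\<close> as long as
  \<open>q (j - 1) - p (j - 1) > q j - p j\<close> and \<open>p j\<close> afterwards. Applied to the operators \<open>Y\<close>, the
  switching points obey a Lindley recursion, which is the recursion for \<open>Omega\<close>; its partial sums are
  sums along Dyck paths, so the bound \<open>m\<close> keeps all operators defined. On the array side the same
  word of operators first stores all upper entries in the last column of the zero array and then
  carries the columns of \<open>A\<close> to their places one after the other, inside the polytope, so that it
  produces \<open>A\<close>.\<close>

section \<open>Crystal operators on tableaux with three letters per row\<close>

definition unpaired_low :: "nat \<Rightarrow> ('c \<times> nat) list \<Rightarrow> ('c \<times> nat) list" where
  "unpaired_low j w = filter (\<lambda>x. snd x = j) (unpaired j w)"

lemma unpaired_low_Nil [simp]: "unpaired_low j [] = []"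
  by (simp add: unpaired_low_def)

lemma unpaired_low_eq_Nil:
  assumes "unpaired j w = y # ys" "snd y \<noteq> j"
  shows "unpaired_low j w = []"
proof -
  obtain a b where ab: "map snd (unpaired j w) = replicate a j @ replicate b (j + 1)"
    using unpaired_form by blast
  with assms have "a = 0" by (cases a) auto
  with ab have "set (map snd (unpaired j w)) \<subseteq> {j + 1}" by (simp add: set_replicate_conv_if)
  then show ?thesis by (fastforce simp: unpaired_low_def filter_empty_conv)
qed

text \<open>A letter put in front can only cancel the first unpaired letter, and the unpaired
  \<open>j\<close> precede the unpaired \<open>j + 1\<close>; hence the unpaired \<open>j\<close>
  obey a recursion of their own. The convention \<open>tl [] = []\<close> covers a
  \<open>j + 1\<close> that finds no partner.\<close>

lemma unpaired_low_Cons: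
  "unpaired_low j (x # w) =
     (if snd x = j then x # unpaired_low j w
      else if snd x = j + 1 then tl (unpaired_low j w) else unpaired_low j w)"
proof (cases "unpaired j w")
  case Nil
  then show ?thesis by (auto simp: unpaired_low_def)
next
  case (Cons y ys)
  show ?thesis
  proof (cases "snd y = j")
    case True
    then show ?thesis using Cons by (auto simp: unpaired_low_def)
  next
    case False
    then show ?thesis using unpaired_low_eq_Nil[OF Cons False] Cons
      by (auto simp: unpaired_low_def)
  qed
qed

text \<open>In a sorted block the letters \<open>j + 1\<close> stand to the right of the letters
  \<open>j\<close>. They meet the unpaired letters of \<open>w\<close> first and cancel a prefix of
  them, after which the letters \<open>j\<close> of the block survive.\<close>

lemma unpaired_low_append:
  assumes "sorted (map snd xs)"
  shows "unpaired_low j (xs @ w) =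
    filter (\<lambda>x. snd x = j) xs @ drop (length (filter (\<lambda>x. snd x = j + 1) xs)) (unpaired_low j w)"
  using assms
proof (induction xs)
  case (Cons x xs)
  have "filter (\<lambda>x. snd x = j) xs = []" if "snd x = j + 1"
    using Cons.prems that by (fastforce simp: filter_empty_conv)
  then show ?case using Cons by (auto simp: unpaired_low_Cons drop_Suc drop_tl)
qed simp

section \<open>Tableaux with three letters per row, encoded by profiles\<close>

definition tableau_row :: "nat \<Rightarrow> tableau \<Rightarrow> nat \<Rightarrow> ((nat \<times> nat) \<times> nat) list" where
  "tableau_row m T s = map (\<lambda>c. ((s, c), T s c)) [1..<m + 1]"

lemma reading_word_0 [simp]: "reading_word 0 m T = []"
  by (simp add: reading_word_def)

lemma reading_word_Suc: "reading_word (Suc s) m T = tableau_row m T (Suc s) @ reading_word s m T"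
  by (simp add: reading_word_def tableau_row_def)

text \<open>Row \<open>s\<close> consists of \<open>p s\<close> letters \<open>s\<close>, \<open>q s - p s\<close> letters \<open>s + 1\<close> and \<open>m - q s\<close> letters
  \<open>s + 2\<close>. The values of \<open>p\<close> and \<open>q\<close> outside \<open>{1..i}\<close> prescribed by \<open>profile\<close> make the missing
  rows above and below the tableau contribute nothing to the rule for \<open>f\<^sub>j\<close>.\<close>

definition profile :: "nat \<Rightarrow> nat \<Rightarrow> (nat \<Rightarrow> int) \<Rightarrow> (nat \<Rightarrow> int) \<Rightarrow> bool" where
  "profile i m p q \<longleftrightarrow> p 0 = int m \<and> q 0 = int m \<and> (\<forall>s>i. p s = 0 \<and> q s = 0) \<and>
     (\<forall>s. 0 \<le> p s \<and> p s \<le> q s \<and> q s \<le> int m \<and> p (Suc s) \<le> p s \<and> q (Suc s) \<le> q s)"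

definition profile_tableau :: "nat \<Rightarrow> nat \<Rightarrow> (nat \<Rightarrow> int) \<Rightarrow> (nat \<Rightarrow> int) \<Rightarrow> tableau" where
  "profile_tableau i m p q = (\<lambda>s c. if 1 \<le> s \<and> s \<le> i \<and> 1 \<le> c \<and> c \<le> m
     then s + (if int c \<le> p s then 0 else if int c \<le> q s then 1 else 2) else 0)"

lemma profileD:
  assumes "profile i m p q"
  shows "p 0 = int m" "q 0 = int m" "i < s \<Longrightarrow> p s = 0" "i < s \<Longrightarrow> q s = 0"
    "0 \<le> p s" "p s \<le> q s" "q s \<le> int m" "p (Suc s) \<le> p s" "q (Suc s) \<le> q s"
  using assms unfolding profile_def by blast+

text \<open>Strictness down a column says that the excess of an entry over its row index does not
  decrease, which is the monotonicity of \<open>p\<close> and \<open>q\<close>. The largest possible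
  entry is \<open>i + 2\<close>, hence \<open>i < n\<close>.\<close>

lemma profile_tableau_ssyt:
  assumes "profile i m p q" "i < n"
  shows "profile_tableau i m p q \<in> ssyt n i m"
proof -
  have "profile_tableau i m p q s c < profile_tableau i m p q (s + 1) c"
    if "s \<in> {1..<i}" "c \<in> {1..m}" for s c
    using that profileD(8,9)[OF assms(1), of s] by (auto simp: profile_tableau_def)
  moreover have "profile_tableau i m p q s c \<le> profile_tableau i m p q s (c + 1)"
    if "s \<in> {1..i}" "c \<in> {1..<m}" for s c
    using that profileD(6)[OF assms(1), of s] by (auto simp: profile_tableau_def)
  moreover have "profile_tableau i m p q s c \<in> {1..n + 1}"
    if "s \<in> {1..i}" "c \<in> {1..m}" for s c
    using that assms(2) by (auto simp: profile_tableau_def)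
  moreover have "profile_tableau i m p q s c = 0"
    if "\<not> (1 \<le> s \<and> s \<le> i \<and> 1 \<le> c \<and> c \<le> m)" for s c
    using that unfolding profile_tableau_def by (rule if_not_P)
  ultimately show ?thesis unfolding ssyt_def by blast
qed

lemma tab_matrix_profile_tableau:
  assumes "profile i m p q" "1 \<le> s" "s \<le> i"
  shows "int (tab_matrix m (profile_tableau i m p q) s 1) = p s"
    "int (tab_matrix m (profile_tableau i m p q) s 2) = q s - p s"
    "int (tab_matrix m (profile_tableau i m p q) s 3) = int m - q s"
proof -
  note d = profileD(5-7)[OF assms(1), of s]
  have "{c \<in> {1..m}. profile_tableau i m p q s c = s + 1 - 1} = {1..nat (p s)}"
    using assms d by (auto simp: profile_tableau_def split: if_splits)
  then show "int (tab_matrix m (profile_tableau i m p q) s 1) = p s"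
    using d by (simp add: tab_matrix_def)
  have "{c \<in> {1..m}. profile_tableau i m p q s c = s + 2 - 1} = {nat (p s)<..nat (q s)}"
    using assms d by (auto simp: profile_tableau_def split: if_splits)
  then show "int (tab_matrix m (profile_tableau i m p q) s 2) = q s - p s"
    using d by (simp add: tab_matrix_def)
  have "{c \<in> {1..m}. profile_tableau i m p q s c = s + 3 - 1} = {nat (q s)<..m}"
    using assms d by (auto simp: profile_tableau_def split: if_splits)
  then show "int (tab_matrix m (profile_tableau i m p q) s 3) = int m - q s"
    using d by (simp add: tab_matrix_def)
qed

definition row_cells :: "nat \<Rightarrow> nat \<Rightarrow> int \<Rightarrow> int \<Rightarrow> ((nat \<times> nat) \<times> nat) list" where
  "row_cells j s a b = map (\<lambda>c. ((s, c), j)) [nat a + 1..<nat b + 1]"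

lemma length_row_cells [simp]: "length (row_cells j s a b) = nat b - nat a"
  by (simp add: row_cells_def del: upt_Suc)

lemma filter_upt_eq:
  assumes "\<And>c. a \<le> c \<Longrightarrow> c < b \<Longrightarrow> P c \<longleftrightarrow> l \<le> c \<and> c < u" "a \<le> l" "u \<le> b"
  shows "filter P [a..<b] = [l..<u]"
  by (rule sorted_distinct_set_unique) (use assms in \<open>auto simp: sorted_wrt_filter\<close>)

lemma filter_tableau_row:
  assumes "profile i m p q" "1 \<le> s" "s \<le> i"
  shows "filter (\<lambda>x. snd x = j) (tableau_row m (profile_tableau i m p q) s) =
    (if j = s then row_cells j s 0 (p s)
     else if j = s + 1 then row_cells j s (p s) (q s)
     else if j = s + 2 then row_cells j s (q s) (int m) else [])"
proof -
  note d = profileD(5-7)[OF assms(1), of s]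
  let ?T = "profile_tableau i m p q"
  have "filter (\<lambda>x. snd x = j) (tableau_row m ?T s) =
      map (\<lambda>c. ((s, c), j)) (filter (\<lambda>c. ?T s c = j) [1..<m + 1])"
    unfolding tableau_row_def filter_map comp_def by (auto intro: map_cong)
  moreover have "filter (\<lambda>c. ?T s c = j) [1..<m + 1] =
    (if j = s then [1..<nat (p s) + 1] else if j = s + 1 then [nat (p s) + 1..<nat (q s) + 1]
     else if j = s + 2 then [nat (q s) + 1..<m + 1] else [])"
    using assms d
    by (auto intro!: filter_upt_eq simp: profile_tableau_def filter_empty_conv simp del: upt_Suc)
  ultimately show ?thesis by (auto simp: row_cells_def simp del: upt_Suc)
qed

lemma sorted_tableau_row:
  assumes "profile i m p q"
  shows "sorted (map snd (tableau_row m (profile_tableau i m p q) s))"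
proof -
  have "profile_tableau i m p q s c \<le> profile_tableau i m p q s c'"
    if "1 \<le> c" "c \<le> c'" "c' \<le> m" for c c'
    using that profileD(6)[OF assms, of s] by (auto simp: profile_tableau_def)
  then show ?thesis
    by (auto simp: tableau_row_def sorted_iff_nth_mono simp del: upt_Suc)
qed

section \<open>The rule for the lowering operators on profiles and for their powers\<close>

lemma unpaired_low_reading_word_Suc:
  assumes "profile i m p q" "s < i"
  shows "unpaired_low j (reading_word (Suc s) m (profile_tableau i m p q)) =
    (let J = unpaired_low j (reading_word s m (profile_tableau i m p q)) in
     if j = Suc s then row_cells j j 0 (p j) @ drop (nat (q j) - nat (p j)) J
     else if j = Suc (Suc s) then row_cells j (Suc s) (p (Suc s)) (q (Suc s)) @
       drop (m - nat (q (Suc s))) J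
     else if j = Suc (Suc (Suc s)) then row_cells j (Suc s) (q (Suc s)) (int m) @ J
     else if j = s then drop (nat (p (Suc s))) J else J)"
  using assms
  by (auto simp: reading_word_Suc unpaired_low_append[OF sorted_tableau_row[OF assms(1)]]
      filter_tableau_row Let_def)

text \<open>Letters \<open>k + 1\<close> occur only in rows \<open>k - 1\<close>, \<open>k\<close>,
  \<open>k + 1\<close>, letters \<open>k + 2\<close> only in rows \<open>k\<close>,
  \<open>k + 1\<close>, \<open>k + 2\<close>. Row \<open>k\<close> cancels all that row
  \<open>k - 1\<close> offers; row \<open>k + 1\<close> cancels part of row \<open>k\<close> and
  adds its first block; row \<open>k + 2\<close> cancels from the left.\<close>

lemma unpaired_low_reading_word:
  assumes pr: "profile i m p q" and "k \<le> i"
  shows "unpaired_low (Suc k) (reading_word i m (profile_tableau i m p q)) =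
    drop (nat (p (k + 2))) (row_cells (Suc k) (Suc k) 0 (p (Suc k)) @
      drop (nat (q (Suc k)) - nat (p (Suc k))) (row_cells (Suc k) k (p k) (q k)))"
proof -
  let ?J = "\<lambda>s. unpaired_low (Suc k) (reading_word s m (profile_tableau i m p q))"
  let ?X = "row_cells (Suc k) (Suc k) 0 (p (Suc k)) @
      drop (nat (q (Suc k)) - nat (p (Suc k))) (row_cells (Suc k) k (p k) (q k))"
  note step = unpaired_low_reading_word_Suc[OF pr, of _ "Suc k"]
  note d = profileD[OF pr]
  \<comment> \<open>Rows up to \<open>k - 2\<close> contain no letter above
    \<open>k\<close>.\<close>
  have 1: "s + 1 < k \<Longrightarrow> ?J s = []" for s
    using \<open>k \<le> i\<close> by (induction s) (auto simp: step)
  have 2: "?J k = row_cells (Suc k) k (p k) (q k)"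
  proof (cases k)
    case 0
    then show ?thesis by (simp add: row_cells_def d)
  next
    case (Suc s)
    \<comment> \<open>Row \<open>s = k - 1\<close> offers its third block, of length
      \<open>m - q s\<close>. Row \<open>k\<close> holds \<open>m - q k\<close> letters
      \<open>k + 2\<close>, at least as many, so none of that block survives.\<close>
    have "length (?J s) \<le> m - nat (q s)"
    proof (cases s)
      case (Suc t)
      then show ?thesis using 1[of t] \<open>k = Suc s\<close> \<open>k \<le> i\<close> step[of t] by simp
    qed simp
    moreover have "nat (q k) \<le> nat (q s)" using d(9)[of s] Suc by simp
    ultimately have "length (?J s) \<le> m - nat (q k)" by linarith
    then show ?thesis using Suc \<open>k \<le> i\<close> step[of s] by simp
  qed
  have 3: "?J (Suc k) = ?X" if "k < i" using that 2 by (simp add: step)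
  have 4: "?J (k + 2 + t) = drop (nat (p (k + 2))) ?X" if "k + 2 + t \<le> i" for t
    using that
  proof (induction t)
    case 0
    then show ?case using 3 by (simp add: step)
  next
    case (Suc t)
    then show ?case by (simp add: step)
  qed
  \<comment> \<open>If row \<open>k + 1\<close> or \<open>k + 2\<close> is missing, the zeros of the
    profile beyond \<open>i\<close> make the same formula hold.\<close>
  consider "i = k" | "i = Suc k" | t where "i = k + 2 + t"
  proof -
    have "i = k \<or> i = Suc k \<or> i = k + 2 + (i - (k + 2))" using \<open>k \<le> i\<close> by linarith
    then show thesis using that by blast
  qed
  then show ?thesis
  proof cases
    case 1
    then show ?thesis using 2 by (simp add: d) (simp add: row_cells_def)
  next
    case 2
    then show ?thesis using 3 by (simp add: d)
  next
    case 3
    then show ?thesis using 4 by simp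
  qed
qed

text \<open>The second block of row \<open>k\<close> is longer than that of row
  \<open>k + 1\<close>, so its end, in column \<open>q k\<close>, is the rightmost unpaired letter.
  Columns stay strict because \<open>p (Suc k) \<le> p k\<close> turns the assumption into
  \<open>q (Suc k) < q k\<close>.\<close>

lemma tab_f_profile_upper:
  assumes pr: "profile i m p q" and "k \<le> i" and lt: "q (Suc k) - p (Suc k) < q k - p k"
  shows "tab_f i m (Suc k) (profile_tableau i m p q) = Some (profile_tableau i m p (q(k := q k - 1)))"
    and "profile i m p (q(k := q k - 1))"
proof -
  note d = profileD[OF pr]
  let ?Y = "drop (nat (q (Suc k)) - nat (p (Suc k))) (row_cells (Suc k) k (p k) (q k))"
  \<comment> \<open>The fictitious row 0 has an empty second block, so the assumption excludes
    it.\<close>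
  have k: "0 < k" using lt d(1,2) d(6)[of "Suc k"] by (cases k) auto
  have Y: "?Y \<noteq> []" "last ?Y = ((k, nat (q k)), Suc k)"
    using lt d(5,6)[of k] d(5,6)[of "Suc k"]
    by (auto simp: row_cells_def last_map last_drop)
  have "unpaired_low (Suc k) (reading_word i m (profile_tableau i m p q)) =
      drop (nat (p (k + 2))) (row_cells (Suc k) (Suc k) 0 (p (Suc k))) @ ?Y"
    using unpaired_low_reading_word[OF pr \<open>k \<le> i\<close>] d(8)[of "Suc k"] by simp
  then have "tab_f i m (Suc k) (profile_tableau i m p q) =
      Some (set_entry k (nat (q k)) (Suc k + 1) (profile_tableau i m p q))"
    using Y by (simp add: tab_f_def unpaired_low_def Let_def)
  moreover have "set_entry k (nat (q k)) (Suc k + 1) (profile_tableau i m p q) =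
      profile_tableau i m p (q(k := q k - 1))"
    using k \<open>k \<le> i\<close> lt d(5-7)[of k] d(5,6)[of "Suc k"]
    by (fastforce simp: set_entry_def profile_tableau_def fun_eq_iff)
  ultimately show "tab_f i m (Suc k) (profile_tableau i m p q) =
      Some (profile_tableau i m p (q(k := q k - 1)))" by simp
  show "profile i m p (q(k := q k - 1))"
    unfolding profile_def
  proof (intro conjI allI impI)
    fix s
    show "p s \<le> (q(k := q k - 1)) s" "(q(k := q k - 1)) s \<le> int m"
        "(q(k := q k - 1)) (Suc s) \<le> (q(k := q k - 1)) s"
      using lt d(6-9)[of s] d(8)[of k] d(6)[of "Suc k"] by auto
  qed (use k d \<open>k \<le> i\<close> in auto)
qed

text \<open>Here the second block of row \<open>k\<close> is cancelled completely. The rightmost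
  unpaired letter is the end of the first block of row \<open>k + 1\<close>, which the fewer letters
  of row \<open>k + 2\<close> do not reach.\<close>

lemma tab_f_profile_lower:
  assumes pr: "profile i m p q" and "k \<le> i" and le: "q k - p k \<le> q (Suc k) - p (Suc k)"
    and lt: "p (k + 2) < p (Suc k)"
  shows "tab_f i m (Suc k) (profile_tableau i m p q) =
      Some (profile_tableau i m (p(Suc k := p (Suc k) - 1)) q)"
    and "profile i m (p(Suc k := p (Suc k) - 1)) q"
proof -
  note d = profileD[OF pr]
  have k: "Suc k \<le> i" using lt d(3)[of "Suc k"] d(5)[of "k + 2"] by (cases "Suc k \<le> i") auto
  have "unpaired_low (Suc k) (reading_word i m (profile_tableau i m p q)) =
      drop (nat (p (k + 2))) (row_cells (Suc k) (Suc k) 0 (p (Suc k)))"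
    using unpaired_low_reading_word[OF pr \<open>k \<le> i\<close>] le d(5,6)[of k] d(5,6)[of "Suc k"] by simp
  then have "tab_f i m (Suc k) (profile_tableau i m p q) =
      Some (set_entry (Suc k) (nat (p (Suc k))) (Suc k + 1) (profile_tableau i m p q))"
    using lt d(5)[of "Suc k"] d(5)[of "k + 2"]
    by (auto simp: tab_f_def unpaired_low_def Let_def row_cells_def last_map last_drop)
  moreover have "set_entry (Suc k) (nat (p (Suc k))) (Suc k + 1) (profile_tableau i m p q) =
      profile_tableau i m (p(Suc k := p (Suc k) - 1)) q"
    using k lt d(5-7)[of "Suc k"] d(5)[of "k + 2"]
    by (fastforce simp: set_entry_def profile_tableau_def fun_eq_iff)
  ultimately show "tab_f i m (Suc k) (profile_tableau i m p q) =
      Some (profile_tableau i m (p(Suc k := p (Suc k) - 1)) q)" by simp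
  show "profile i m (p(Suc k := p (Suc k) - 1)) q"
    unfolding profile_def
  proof (intro conjI allI impI)
    fix s
    show "0 \<le> (p(Suc k := p (Suc k) - 1)) s" "(p(Suc k := p (Suc k) - 1)) s \<le> q s"
        "(p(Suc k := p (Suc k) - 1)) (Suc s) \<le> (p(Suc k := p (Suc k) - 1)) s"
      using lt d(5,6,8)[of s] d(5)[of "k + 2"] by auto
  qed (use k d in auto)
qed

lemma tab_f_pow_chain:
  assumes "\<And>e. e < c \<Longrightarrow> tab_f i m j (X e) = Some (X (Suc e))"
  shows "tab_f_pow i m j c (Some (X 0)) = Some (X c)"
  using assms by (induction c) (auto simp: tab_f_pow_def)

lemma tab_f_pow_add: "tab_f_pow i m j (c + d) x = tab_f_pow i m j d (tab_f_pow i m j c x)"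
  by (metis add.commute comp_apply funpow_add tab_f_pow_def)

lemma tab_f_pow_profile_upper:
  assumes pr: "profile i m p q" and "k \<le> i" and le: "int c \<le> (q k - p k) - (q (Suc k) - p (Suc k))"
  shows "tab_f_pow i m (Suc k) c (Some (profile_tableau i m p q)) =
      Some (profile_tableau i m p (q(k := q k - int c)))"
    and "profile i m p (q(k := q k - int c))"
proof -
  have pr': "profile i m p (q(k := q k - int e))" if "e \<le> c" for e
    using that
  proof (induction e)
    case (Suc e)
    then show ?case
      using tab_f_profile_upper(2)[OF Suc.IH \<open>k \<le> i\<close>] le
      by (simp add: fun_upd_def algebra_simps cong: if_cong)
  qed (use pr in simp)
  then show "profile i m p (q(k := q k - int c))" by simp
  have "tab_f i m (Suc k) (profile_tableau i m p (q(k := q k - int e))) =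
      Some (profile_tableau i m p (q(k := q k - int (Suc e))))" if "e < c" for e
    using tab_f_profile_upper(1)[OF pr', of e] that \<open>k \<le> i\<close> le by (simp add: algebra_simps)
  from tab_f_pow_chain[of c i m "Suc k" "\<lambda>e. profile_tableau i m p (q(k := q k - int e))", OF this]
  show "tab_f_pow i m (Suc k) c (Some (profile_tableau i m p q)) =
      Some (profile_tableau i m p (q(k := q k - int c)))" by simp
qed

lemma tab_f_pow_profile_lower:
  assumes pr: "profile i m p q" and "k \<le> i" and le: "q k - p k \<le> q (Suc k) - p (Suc k)"
    and lt: "int c \<le> p (Suc k) - p (k + 2)"
  shows "tab_f_pow i m (Suc k) c (Some (profile_tableau i m p q)) =
      Some (profile_tableau i m (p(Suc k := p (Suc k) - int c)) q)"
    and "profile i m (p(Suc k := p (Suc k) - int c)) q"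
proof -
  have pr': "profile i m (p(Suc k := p (Suc k) - int e)) q" if "e \<le> c" for e
    using that
  proof (induction e)
    case (Suc e)
    then show ?case
      using tab_f_profile_lower(2)[OF Suc.IH \<open>k \<le> i\<close>] le lt
      by (simp add: fun_upd_def algebra_simps cong: if_cong)
  qed (use pr in simp)
  then show "profile i m (p(Suc k := p (Suc k) - int c)) q" by simp
  have "tab_f i m (Suc k) (profile_tableau i m (p(Suc k := p (Suc k) - int e)) q) =
      Some (profile_tableau i m (p(Suc k := p (Suc k) - int (Suc e))) q)" if "e < c" for e
    using tab_f_profile_lower(1)[OF pr', of e] that \<open>k \<le> i\<close> le lt by (simp add: algebra_simps)
  from tab_f_pow_chain[of c i m "Suc k" "\<lambda>e. profile_tableau i m (p(Suc k := p (Suc k) - int e)) q",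
      OF this]
  show "tab_f_pow i m (Suc k) c (Some (profile_tableau i m p q)) =
      Some (profile_tableau i m (p(Suc k := p (Suc k) - int c)) q)" by simp
qed

text \<open>Lowering \<open>q k\<close> reduces the excess of the second block of row
  \<open>k\<close> over that of row \<open>k + 1\<close> by one, and lowering
  \<open>p (Suc k)\<close> never restores it. So the first \<open>e\<close> applications are of the
  first kind and all later ones of the second.\<close>

lemma tab_f_pow_profile:
  assumes pr: "profile i m p q" and "k \<le> i"
    and e: "e = min (int c) (max 0 ((q k - p k) - (q (Suc k) - p (Suc k))))"
    and le: "int c - e \<le> p (Suc k) - p (k + 2)"
  shows "tab_f_pow i m (Suc k) c (Some (profile_tableau i m p q)) =
      Some (profile_tableau i m (p(Suc k := p (Suc k) - (int c - e))) (q(k := q k - e)))" (is ?A)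
    and "profile i m (p(Suc k := p (Suc k) - (int c - e))) (q(k := q k - e))" (is ?B)
proof -
  have "?A \<and> ?B"
  proof (cases "int c \<le> (q k - p k) - (q (Suc k) - p (Suc k))")
    case True
    then have "e = int c" using e by simp
    then show ?thesis using tab_f_pow_profile_upper[OF pr \<open>k \<le> i\<close> True] by simp
  next
    case False
    then have e0: "0 \<le> e" "nat e \<le> c" "(q k - p k) - (q (Suc k) - p (Suc k)) \<le> e"
      using e by auto
    have up: "tab_f_pow i m (Suc k) (nat e) (Some (profile_tableau i m p q)) =
        Some (profile_tableau i m p (q(k := q k - e)))" "profile i m p (q(k := q k - e))"
      using tab_f_pow_profile_upper[OF pr \<open>k \<le> i\<close>, of "nat e"] pr e False
      by (cases "e = 0"; simp add: tab_f_pow_def max_def split: if_splits)+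
    have c: "int (c - nat e) = int c - e" using e0 by (simp add: of_nat_diff)
    note lo = tab_f_pow_profile_lower[OF up(2) \<open>k \<le> i\<close>, of "c - nat e", unfolded c]
    have "tab_f_pow i m (Suc k) c (Some (profile_tableau i m p q)) =
        tab_f_pow i m (Suc k) (c - nat e) (Some (profile_tableau i m p (q(k := q k - e))))"
      using tab_f_pow_add[of i m "Suc k" "nat e" "c - nat e"] e0 up by simp
    then show ?thesis using lo e0 le by simp
  qed
  then show ?A ?B by auto
qed

section \<open>Dyck paths for arrays with two rows\<close>

text \<open>The path that follows row \<open>n - 1\<close> up to column \<open>r\<close>, rises
  there and continues in row \<open>n\<close>; the shift \<open>t - 1\<close> pays for the vertical
  step.\<close>

definition switch_path :: "nat \<Rightarrow> nat \<Rightarrow> nat \<Rightarrow> nat \<times> nat" where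
  "switch_path n r t = (if t \<le> r then (t, n - 1) else (t - 1, n))"

lemma dyck_path_switch_path:
  assumes "1 \<le> r" "r \<le> n - 1"
  shows "dyck_path n (n - 1) (switch_path n r)"
  using assms by (auto simp: dyck_path_def switch_path_def)

lemma sum_switch_path:
  fixes A :: array
  assumes "1 \<le> r" "r \<le> n - 1"
  shows "(\<Sum>t=1..n. A (fst (switch_path n r t)) (snd (switch_path n r t))) =
    (\<Sum>p=1..r. A p (n - 1)) + (\<Sum>p=r..n - 1. A p n)"
proof -
  have "{1..n} = {1..r} \<union> {Suc r..Suc (n - 1)}" using assms by auto
  moreover have "(\<Sum>t=Suc r..Suc (n - 1). A (fst (switch_path n r t)) (snd (switch_path n r t))) =
      (\<Sum>p=r..n - 1. A p n)"
    unfolding sum.shift_bounds_cl_Suc_ivl by (rule sum.cong) (auto simp: switch_path_def)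
  moreover have "(\<Sum>t=1..r. A (fst (switch_path n r t)) (snd (switch_path n r t))) =
      (\<Sum>p=1..r. A p (n - 1))"
    by (rule sum.cong) (auto simp: switch_path_def)
  ultimately show ?thesis by (simp add: sum.union_disjoint)
qed

lemma dyck_path_eq_switch_path:
  assumes "2 \<le> n" and \<beta>: "dyck_path n (n - 1) \<beta>"
  obtains r where "1 \<le> r" "r \<le> n - 1" "\<And>t. t \<in> {1..n} \<Longrightarrow> \<beta> t = switch_path n r t"
proof -
  have step: "\<beta> (t + 1) \<in> {(fst (\<beta> t), snd (\<beta> t) + 1), (fst (\<beta> t) + 1, snd (\<beta> t))}"
    if "1 \<le> t" "t < n" for t
    using \<beta> that by (simp add: dyck_path_def)
  \<comment> \<open>The premise on the second coordinate excludes a second rise; it passes back to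
    earlier times because that coordinate never decreases, and the endpoint supplies it at the end.
    While the path is in the lower row, the witness is adjusted to \<open>t\<close> or
    \<open>Suc t\<close> at each step.\<close>
  have "snd (\<beta> t) \<le> n \<longrightarrow> (\<exists>r\<ge>1. \<forall>t'\<in>{1..t}. \<beta> t' = switch_path n r t')"
    if "1 \<le> t" "t \<le> n" for t
    using that
  proof (induction t rule: nat_induct_at_least)
    case base
    then show ?case using \<beta> by (auto simp: dyck_path_def switch_path_def)
  next
    case (Suc t)
    show ?case
    proof
      assume le: "snd (\<beta> (Suc t)) \<le> n"
      have st: "\<beta> (Suc t) = (fst (\<beta> t), Suc (snd (\<beta> t))) \<or> \<beta> (Suc t) = (Suc (fst (\<beta> t)), snd (\<beta> t))"
        using step[of t] Suc by simp
      then have "snd (\<beta> t) \<le> n" using le by auto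
      then obtain r where r: "1 \<le> r" "\<And>t'. t' \<in> {1..t} \<Longrightarrow> \<beta> t' = switch_path n r t'"
        using Suc by auto
      have bt: "\<beta> t = switch_path n r t" using r(2)[of t] Suc by simp
      let ?P = "\<lambda>r'. 1 \<le> r' \<and> (\<forall>t'\<in>{1..Suc t}. \<beta> t' = switch_path n r' t')"
      show "\<exists>r\<ge>1. \<forall>t'\<in>{1..Suc t}. \<beta> t' = switch_path n r t'"
      proof (cases "t \<le> r")
        case True
        then have b: "\<beta> t' = (t', n - 1)" if "t' \<in> {1..t}" for t'
          using r(2)[OF that] that by (simp add: switch_path_def)
        from st have "\<beta> (Suc t) = (t, n) \<or> \<beta> (Suc t) = (Suc t, n - 1)"
          using b[of t] Suc \<open>2 \<le> n\<close> by auto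
        then have "?P t \<or> ?P (Suc t)"
          using b Suc by (auto simp: switch_path_def le_Suc_eq)
        then show ?thesis by blast
      next
        case False
        then have "\<beta> (Suc t) = (t, n)"
          using st bt le by (auto simp: switch_path_def)
        then have "?P r" using r False by (auto simp: switch_path_def le_Suc_eq)
        then show ?thesis by blast
      qed
    qed
  qed
  moreover have "\<beta> n = (n - 1, n)" using \<beta> by (simp add: dyck_path_def)
  ultimately obtain r where r: "1 \<le> r" "\<And>t. t \<in> {1..n} \<Longrightarrow> \<beta> t = switch_path n r t"
    using \<open>2 \<le> n\<close> by (metis le_refl one_le_numeral order_trans snd_conv)
  moreover have "r \<le> n - 1"
  proof (rule ccontr)
    assume "\<not> r \<le> n - 1"
    then have "switch_path n r n = (n, n - 1)" by (simp add: switch_path_def)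
    then show False using r(2)[of n] \<open>\<beta> n = (n - 1, n)\<close> \<open>2 \<le> n\<close> by auto
  qed
  ultimately show thesis using that by blast
qed

lemma kus_arrays_iff:
  assumes "2 \<le> n"
  shows "A \<in> kus_arrays n (n - 1) m \<longleftrightarrow>
    (\<forall>p q. \<not> (1 \<le> p \<and> p \<le> n - 1 \<and> n - 1 \<le> q \<and> q \<le> n) \<longrightarrow> A p q = 0) \<and>
    (\<forall>r\<in>{1..n - 1}. (\<Sum>p=1..r. A p (n - 1)) + (\<Sum>p=r..n - 1. A p n) \<le> m)"
proof -
  have "(\<forall>\<beta>. dyck_path n (n - 1) \<beta> \<longrightarrow> (\<Sum>r=1..n. A (fst (\<beta> r)) (snd (\<beta> r))) \<le> m) \<longleftrightarrow>
    (\<forall>r\<in>{1..n - 1}. (\<Sum>p=1..r. A p (n - 1)) + (\<Sum>p=r..n - 1. A p n) \<le> m)" (is "?L \<longleftrightarrow> ?R")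
  proof
    assume ?L
    then show ?R
      using dyck_path_switch_path[of _ n] sum_switch_path[of _ n A] by fastforce
  next
    assume R: ?R
    show ?L
    proof (intro allI impI)
      fix \<beta> assume "dyck_path n (n - 1) \<beta>"
      then obtain r where r: "1 \<le> r" "r \<le> n - 1" "\<And>t. t \<in> {1..n} \<Longrightarrow> \<beta> t = switch_path n r t"
        using dyck_path_eq_switch_path[OF assms] by blast
      then have "(\<Sum>t=1..n. A (fst (\<beta> t)) (snd (\<beta> t))) =
          (\<Sum>t=1..n. A (fst (switch_path n r t)) (snd (switch_path n r t)))"
        by (intro sum.cong) auto
      then show "(\<Sum>t=1..n. A (fst (\<beta> t)) (snd (\<beta> t))) \<le> m"
        using R r sum_switch_path[of r n A] by simp
    qed
  qed
  then show ?thesis by (simp add: kus_arrays_def)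
qed

section \<open>The tableaux of the theorem\<close>

declare Omega.simps [simp del] nu.simps [simp del]

locale kus_array =
  fixes n m :: nat and A :: array
  assumes n2: "2 \<le> n" and A_in: "A \<in> kus_arrays n (n - 1) m"
begin

section \<open>The Lindley recursion and the bounds it yields\<close>

abbreviation "lower c \<equiv> int (A c (n - 1))"
abbreviation "upper c \<equiv> int (A c n)"

definition "upper_total = (\<Sum>p=1..n - 1. upper p)"

definition "idle k = (\<Sum>j=1..k. nu n A j * Omega n A j)"

lemma A_outside: "\<not> (1 \<le> p \<and> p \<le> n - 1 \<and> n - 1 \<le> q \<and> q \<le> n) \<Longrightarrow> A p q = 0"
  using A_in kus_arrays_iff[OF n2] by blast

lemma path_bound:
  assumes "1 \<le> r" "r \<le> n - 1"
  shows "(\<Sum>p=1..r. A p (n - 1)) + (\<Sum>p=r..n - 1. A p n) \<le> m"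
  using A_in assms unfolding kus_arrays_iff[OF n2] by simp

text \<open>\<open>nu\<close> marks the negative values of \<open>Omega\<close>; at index 1, where
  it is 1 by definition, \<open>Omega\<close> is not positive, and at index 0 it vanishes.\<close>

lemma nu_Omega:
  "nu n A k * Omega n A k = min 0 (Omega n A k)"
  "(1 - nu n A k) * Omega n A k = max 0 (Omega n A k)"
proof -
  consider "k = 0" | "k = Suc 0" | l where "k = Suc (Suc l)"
    using not0_implies_Suc by blast
  then have "nu n A k = (if Omega n A k < 0 then 1 else 0) \<or> Omega n A k = 0 \<or>
      nu n A k = 1 \<and> Omega n A k \<le> 0"
    by cases (simp_all add: Omega.simps(1,2) nu.simps)
  then show "nu n A k * Omega n A k = min 0 (Omega n A k)"
    "(1 - nu n A k) * Omega n A k = max 0 (Omega n A k)"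
    by (auto split: if_splits)
qed

lemma Omega_Suc:
  "Omega n A (Suc k) = upper k + max 0 (Omega n A k) - lower (Suc k)"
  using A_outside[of 0 n] by (cases k) (auto simp: nu_Omega Omega.simps)

lemma idle_simps: "idle 0 = 0" "idle (Suc k) = idle k + min 0 (Omega n A (Suc k))"
  by (simp_all add: idle_def nu_Omega)

text \<open>The reflection identity of the Lindley recursion: whenever \<open>Omega\<close> is negative, it turns the
  accumulated idle time into a difference of partial sums along the rows of \<open>A\<close>.\<close>

lemma idle_eq:
  "idle (Suc k) + max 0 (Omega n A (Suc k)) = (\<Sum>j=1..k. upper j) - (\<Sum>j=1..Suc k. lower j)"
proof (induction k)
  case (Suc k)
  have "min 0 (Omega n A (Suc (Suc k))) + max 0 (Omega n A (Suc (Suc k))) = Omega n A (Suc (Suc k))"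
    by simp
  with Suc show ?case unfolding idle_simps(2)[of "Suc k"] Omega_Suc[of "Suc k"] by simp
qed (simp add: idle_simps Omega.simps)

lemma upper_total_split:
  assumes "k \<le> n - 1"
  shows "upper_total = (\<Sum>j=1..k. upper j) + (\<Sum>j=Suc k..n - 1. upper j)"
proof -
  have "{1..n - 1} = {1..k} \<union> {Suc k..n - 1}" using assms by auto
  then show ?thesis by (simp add: upper_total_def sum.union_disjoint)
qed

text \<open>If \<open>Omega\<close> is negative at \<open>Suc k\<close>, the reflection identity
  turns the left side into the sum of \<open>A\<close> along the path that changes rows in column
  \<open>Suc k\<close>. Otherwise \<open>idle\<close> does not change.\<close>

lemma upper_total_idle_bound:
  assumes "k \<le> n - 1"
  shows "upper_total - idle k \<le> int m"
  using assms
proof (induction k)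
  case 0
  have "(\<Sum>p=1..n - 1. A p n) \<le> m" using path_bound[of 1] n2 by linarith
  then have "int (\<Sum>p=1..n - 1. A p n) \<le> int m" by (rule of_nat_mono)
  then show ?case by (simp add: idle_simps upper_total_def)
next
  case (Suc k)
  show ?case
  proof (cases "Omega n A (Suc k) < 0")
    case True
    then have "idle (Suc k) = (\<Sum>j=1..k. upper j) - (\<Sum>j=1..Suc k. lower j)"
      using idle_eq[of k] by simp
    then have "upper_total - idle (Suc k) = int ((\<Sum>p=1..Suc k. A p (n - 1)) + (\<Sum>p=Suc k..n - 1. A p n))"
      using upper_total_split[of k] Suc by simp
    also have "\<dots> \<le> int m"
      using path_bound[of "Suc k"] Suc.prems by (simp only: of_nat_le_iff)
    finally show ?thesis .
  next
    case False
    then show ?thesis using Suc by (simp add: idle_simps)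
  qed
qed

section \<open>The profiles predicted by the theorem\<close>

definition "prow k = int m - (\<Sum>j=1..k. upper j - nu n A j * Omega n A j)"
definition "qrow k = int m - (\<Sum>j=2..k. lower j + nu n A j * Omega n A j)"

text \<open>The number of letters by which \<open>q\<close> is lowered in each row during \<open>Y\<close> with index \<open>Suc k\<close>.\<close>

definition "drop_q k = lower (Suc k) + min 0 (Omega n A (Suc k))"

lemma prow_simps: "prow 0 = int m" "prow (Suc k) = prow k - upper (Suc k) + min 0 (Omega n A (Suc k))"
  by (simp_all add: prow_def nu_Omega)

text \<open>The sum in \<open>qrow\<close> starts at 2, yet the recursion holds from
  \<open>k = 0\<close> on: \<open>Omega\<close> at 1 equals \<open>- lower 1\<close>, so
  \<open>drop_q 0 = 0\<close>.\<close>

lemma qrow_simps: "qrow 0 = int m" "qrow (Suc k) = qrow k - drop_q k"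
  by (auto simp: qrow_def drop_q_def nu_Omega Omega.simps(2) not_less_eq_eq)

lemma drop_q_eq: "drop_q k = min (lower (Suc k)) (upper k + max 0 (Omega n A k))"
  by (simp add: drop_q_def Omega_Suc)

text \<open>\<open>- idle k\<close> is the second block of the last row. The surplus over it is
  exactly the quantity with which \<open>drop_q_eq\<close> compares \<open>lower (Suc k)\<close>;
  this ties the switching points of the operators to \<open>Omega\<close>.\<close>

lemma qrow_minus_prow: "qrow k - prow k = upper k + max 0 (Omega n A k) - idle k"
proof (induction k)
  case 0
  then show ?case using A_outside[of 0 n] by (simp add: qrow_simps prow_simps idle_simps Omega.simps(1))
next
  case (Suc k)
  then show ?case
    by (simp add: qrow_simps(2) prow_simps(2) idle_simps(2) drop_q_def Omega_Suc[of k])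
qed

lemma prow_eq: "prow k = int m - (\<Sum>j=1..k. upper j) + idle k"
  by (simp add: prow_def idle_def sum_subtractf)

lemma prow_bound: "k \<le> n - 1 \<Longrightarrow> int m - upper_total + idle k \<le> prow k"
  using upper_total_split[of k] by (simp add: prow_eq sum_nonneg)

text \<open>The profile after \<open>f\<^sub>t\<close> has been applied in the course of \<open>Y\<close> with index \<open>Suc k\<close>;
  \<open>t = n\<close> is the situation before the first step.\<close>

definition state_p :: "nat \<Rightarrow> nat \<Rightarrow> nat \<Rightarrow> int" where
  "state_p k t s = (if s \<le> k then prow s
     else if s < n - 1 then prow (if t \<le> s then Suc k else k)
     else if s = n - 1 then int m - upper_total + idle (if t \<le> s then Suc k else k) else 0)"

text \<open>The operator with index \<open>Suc s\<close> acts on \<open>q\<close> in row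
  \<open>s\<close> but on \<open>p\<close> in row \<open>Suc s\<close>, so \<open>q\<close> runs one
  index ahead of \<open>p\<close>.\<close>

definition state_q :: "nat \<Rightarrow> nat \<Rightarrow> nat \<Rightarrow> int" where
  "state_q k t s = (if s < k then qrow (Suc s)
     else if s < n - 1 then qrow (if t \<le> Suc s then Suc k else k)
     else if s = n - 1 then int m - upper_total else 0)"

abbreviation "state k t \<equiv> profile_tableau (n - 1) m (state_p k t) (state_q k t)"

text \<open>In the last row, which is treated first, the excess is \<open>D\<close>, so
  \<open>e = min (lower (Suc k)) D\<close> applications lower \<open>q\<close>. In each later step
  the excess is \<open>e\<close> itself, because the preceding step lowered \<open>q\<close> in row
  \<open>Suc l\<close> by \<open>e\<close>.\<close>

lemma state_step:
  assumes "k \<le> l" "Suc l \<le> n - 1"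
    and pr: "profile (n - 1) m (state_p k (l + 2)) (state_q k (l + 2))"
    and c: "c = (if Suc l = n - 1 then A (Suc k) (n - 1) else A (Suc k) (n - 1) + A (Suc k) n)"
  shows "tab_f_pow (n - 1) m (Suc l) c (Some (state k (l + 2))) = Some (state k (l + 1))" (is ?A)
    and "profile (n - 1) m (state_p k (l + 1)) (state_q k (l + 1))" (is ?B)
proof -
  let ?p = "state_p k (l + 2)" and ?q = "state_q k (l + 2)"
  have l: "?q l = qrow k" "?p l = prow k"
    using assms by (auto simp: state_p_def state_q_def)
  define D where "D = upper k + max 0 (Omega n A k)"
  define e where "e = drop_q k"
  have D: "0 \<le> D" "e = min (lower (Suc k)) D" "qrow k - prow k = D - idle k"
    by (simp_all add: D_def e_def drop_q_eq qrow_minus_prow)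
  have min0: "min 0 (Omega n A (Suc k)) = e - lower (Suc k)"
    by (simp add: e_def drop_q_def)
  have "0 \<le> e" "e \<le> lower (Suc k)" using D by simp_all
  note succ = idle_simps(2)[of k, unfolded min0] qrow_simps(2)[of k, folded e_def]
    prow_simps(2)[of k, unfolded min0]
  have e: "e = min (int c) (max 0 ((?q l - ?p l) - (?q (Suc l) - ?p (Suc l))))
      \<and> int c - e \<le> ?p (Suc l) - ?p (l + 2)
      \<and> ?p (Suc l) - (int c - e) = state_p k (l + 1) (Suc l)" (is "?E1 \<and> ?E2 \<and> ?E3")
  proof (cases "Suc l = n - 1")
    case True
    then have s: "?q (Suc l) = int m - upper_total" "?p (Suc l) = int m - upper_total + idle k"
      "?p (l + 2) = 0" "state_p k (l + 1) (Suc l) = int m - upper_total + idle (Suc k)"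
      "int c = lower (Suc k)"
      using assms by (auto simp: state_p_def state_q_def)
    have "(?q l - ?p l) - (?q (Suc l) - ?p (Suc l)) = D"
      unfolding l s using D(3) by simp
    then have ?E1 using D s by simp
    \<comment> \<open>The polytope bound enters here: it keeps the first block of the last row
      nonnegative.\<close>
    moreover have ?E2 ?E3
      unfolding s using upper_total_idle_bound[of "Suc k"] True assms(1,2) succ by simp_all
    ultimately show ?thesis by blast
  next
    case False
    then have s: "?q (Suc l) = qrow (Suc k)" "?p (Suc l) = prow k"
      "?p (l + 2) = (if l + 2 = n - 1 then int m - upper_total + idle (Suc k) else prow (Suc k))"
      "state_p k (l + 1) (Suc l) = prow (Suc k)" "int c = lower (Suc k) + upper (Suc k)"
      using assms by (auto simp: state_p_def state_q_def)
    have "(?q l - ?p l) - (?q (Suc l) - ?p (Suc l)) = e"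
      unfolding l s using succ by simp
    then have ?E1 using \<open>0 \<le> e\<close> \<open>e \<le> lower (Suc k)\<close> s by simp
    moreover have "?p (l + 2) \<le> prow (Suc k)"
      unfolding s using prow_bound[of "Suc k"] assms(1,2) by simp
    then have ?E2 unfolding s(2,5) using succ by simp
    moreover have ?E3 unfolding s using succ by simp
    ultimately show ?thesis by blast
  qed
  have "?p(Suc l := ?p (Suc l) - (int c - e)) = state_p k (l + 1)"
  proof
    fix s
    have "state_p k (l + 2) s = state_p k (l + 1) s" if "s \<noteq> Suc l"
      using that assms(1,2) by (simp add: state_p_def)
    then show "(?p(Suc l := ?p (Suc l) - (int c - e))) s = state_p k (l + 1) s"
      using e by simp
  qed
  moreover have "?q(l := ?q l - e) = state_q k (l + 1)"
    unfolding l using assms(1,2) by (auto simp: state_q_def succ fun_eq_iff)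
  ultimately show ?A ?B
    using tab_f_pow_profile[OF pr, of l e c] e assms(1,2) by simp_all
qed

lemma state_next:
  assumes "k < n - 1"
  shows "state_p k (Suc k) = state_p (Suc k) n" "state_q k (Suc k) = state_q (Suc k) n"
proof -
  \<comment> \<open>For \<open>Suc k = n - 1\<close> the two states describe the last row by
    different clauses, which this equation reconciles.\<close>
  have "prow (n - 1) = int m - upper_total + idle (n - 1)" by (simp add: prow_eq upper_total_def)
  then show "state_p k (Suc k) = state_p (Suc k) n"
    using assms by (auto simp: state_p_def fun_eq_iff le_Suc_eq)
  show "state_q k (Suc k) = state_q (Suc k) n"
    using assms by (auto simp: state_q_def fun_eq_iff less_Suc_eq)
qed

lemma Y_op_state:
  assumes "k < n - 1" and pr: "profile (n - 1) m (state_p k n) (state_q k n)"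
  shows "Y_op n m A (Suc k) (Some (state k n)) = Some (state (Suc k) n)"
    and "profile (n - 1) m (state_p (Suc k) n) (state_q (Suc k) n)"
proof -
  have n: "n - 2 + 2 = n" "n - 2 + 1 = n - 1" "Suc (n - 2) = n - 1" using n2 by auto
  have first: "tab_f_pow (n - 1) m (n - 1) (A (Suc k) (n - 1)) (Some (state k n)) = Some (state k (n - 1))"
    "profile (n - 1) m (state_p k (n - 1)) (state_q k (n - 1))"
    using state_step[of k "n - 2" "A (Suc k) (n - 1)"] pr assms(1) unfolding n by auto
  \<comment> \<open>\<open>foldr\<close> starts with the largest index \<open>n - 2\<close>, so the
    induction runs downwards from the empty list at \<open>t = n - 1\<close>.\<close>
  have "foldr (\<lambda>j. tab_f_pow (n - 1) m j (A (Suc k) (n - 1) + A (Suc k) n)) [t..<n - 1]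
      (Some (state k (n - 1))) = Some (state k t) \<and>
      profile (n - 1) m (state_p k t) (state_q k t)" if "Suc k \<le> t" "t \<le> n - 1" for t
    using that(2,1)
  proof (induction t rule: inc_induct)
    case base
    then show ?case using first by simp
  next
    case (step t)
    then show ?case
      using state_step[of k "t - 1"] by (cases t) (auto simp: upt_conv_Cons)
  qed
  from this[of "Suc k"] show "Y_op n m A (Suc k) (Some (state k n)) = Some (state (Suc k) n)"
    "profile (n - 1) m (state_p (Suc k) n) (state_q (Suc k) n)"
    using assms(1) first by (auto simp: Y_op_def state_next)
qed

text \<open>All second blocks of the highest weight tableau are empty, so \<open>f\<close> with
  index \<open>n - 1\<close> lowers \<open>p\<close> in the last row. The excess created there is
  then consumed by \<open>f\<close> with index \<open>n\<close>, which lowers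
  \<open>q\<close>.\<close>

lemma H_op_state:
  shows "H_op n m A (Some (highest_tableau (n - 1) m)) = Some (state 0 n)"
    and "profile (n - 1) m (state_p 0 n) (state_q 0 n)"
proof -
  have t: "0 \<le> upper_total" "upper_total \<le> int m" "upper_total = int (\<Sum>p=1..n - 1. A p n)"
    using upper_total_idle_bound[of 0] by (auto simp: upper_total_def idle_simps sum_nonneg)
  have n: "Suc (n - 2) = n - 1" "n - 2 + 2 = n" "Suc (n - 1) = n" using n2 by auto
  define p where "p = (\<lambda>s. if s \<le> n - 1 then int m else 0)"
  have hw: "highest_tableau (n - 1) m = profile_tableau (n - 1) m p p"
    by (auto simp: highest_tableau_def profile_tableau_def p_def fun_eq_iff)
  have pr: "profile (n - 1) m p p" by (auto simp: profile_def p_def)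
  define p' where "p' = p(n - 1 := int m - upper_total)"
  have 1: "tab_f_pow (n - 1) m (n - 1) (\<Sum>p=1..n - 1. A p n) (Some (profile_tableau (n - 1) m p p)) =
      Some (profile_tableau (n - 1) m p' p)" "profile (n - 1) m p' p"
    using tab_f_pow_profile_lower[OF pr, of "n - 2" "\<Sum>p=1..n - 1. A p n"] n2 t
    unfolding n by (auto simp: p_def p'_def)
  have "tab_f_pow (n - 1) m n (\<Sum>p=1..n - 1. A p n) (Some (profile_tableau (n - 1) m p' p)) =
      Some (profile_tableau (n - 1) m p' p') \<and> profile (n - 1) m p' p'"
    using tab_f_pow_profile_upper[OF 1(2), of "n - 1" "\<Sum>p=1..n - 1. A p n"] n2 t
    unfolding n by (auto simp: p_def p'_def)
  moreover have "p' = state_p 0 n" "p' = state_q 0 n"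
    using n2 by (auto simp: fun_eq_iff p_def p'_def state_p_def state_q_def prow_simps qrow_simps idle_simps)
  ultimately show "H_op n m A (Some (highest_tableau (n - 1) m)) = Some (state 0 n)"
    "profile (n - 1) m (state_p 0 n) (state_q 0 n)"
    using 1 by (auto simp: H_op_def hw Let_def simp del: One_nat_def)
qed

lemma T_tab_state:
  assumes "k \<le> n - 1"
  shows "T_tab n m A k = Some (state k n)" "profile (n - 1) m (state_p k n) (state_q k n)"
proof -
  have "T_tab n m A k = Some (state k n) \<and> profile (n - 1) m (state_p k n) (state_q k n)"
    using assms
  proof (induction k)
    case 0
    then show ?case using H_op_state by (simp add: T_tab_def)
  next
    case (Suc k)
    then show ?case using Y_op_state[of k] by (simp add: T_tab_def)
  qed
  then show "T_tab n m A k = Some (state k n)" "profile (n - 1) m (state_p k n) (state_q k n)" by auto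
qed

end

section \<open>The operators on arrays\<close>

definition column_array :: "nat \<Rightarrow> (nat \<Rightarrow> nat) \<Rightarrow> (nat \<Rightarrow> nat) \<Rightarrow> array" where
  "column_array n u v = (\<lambda>p q. if 1 \<le> p \<and> p \<le> n - 1
     then (if q = n - 1 then u p else if q = n then v p else 0) else 0)"

lemma column_array_cong:
  assumes "\<And>c. 1 \<le> c \<Longrightarrow> c \<le> n - 1 \<Longrightarrow> u c = u' c" "\<And>c. 1 \<le> c \<Longrightarrow> c \<le> n - 1 \<Longrightarrow> v c = v' c"
  shows "column_array n u v = column_array n u' v'"
  using assms by (auto simp: column_array_def fun_eq_iff)

lemma sum_column_array:
  assumes "2 \<le> n" "1 \<le> a" "b \<le> n - 1"
  shows "(\<Sum>p=a..b. column_array n u v p (n - 1)) = sum u {a..b}"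
    "(\<Sum>p=a..b. column_array n u v p n) = sum v {a..b}"
  using assms by (auto intro!: sum.cong simp: column_array_def)

lemma column_array_kus_arrays_iff:
  assumes "2 \<le> n"
  shows "column_array n u v \<in> kus_arrays n (n - 1) m \<longleftrightarrow>
    (\<forall>r\<in>{1..n - 1}. sum u {1..r} + sum v {r..n - 1} \<le> m)"
proof -
  have "column_array n u v p q = 0" if "\<not> (1 \<le> p \<and> p \<le> n - 1 \<and> n - 1 \<le> q \<and> q \<le> n)" for p q
    using that by (auto simp: column_array_def)
  then show ?thesis
    unfolding kus_arrays_iff[OF assms] using sum_column_array[OF assms] by simp
qed

section \<open>Kus's operators on arrays with two rows\<close>

lemma kus_f_column_array_middle:
  assumes "2 \<le> n" "sum u {1..n - 1} + v (n - 1) < m"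
  shows "kus_f n (n - 1) m (n - 1) (column_array n u v) =
    Some (column_array n (u(n - 1 := Suc (u (n - 1)))) v)"
proof -
  have ne: "n - 1 \<noteq> n" "1 \<le> n - 1" using assms by auto
  have set: "{n - 1..n} = {n - 1, n}" "{1..n - 1} = insert (n - 1) {1..<n - 1}"
    using assms by auto
  have "(\<Sum>j=1..<n - 1. int (column_array n u v j (n - 1))) = int (sum u {1..<n - 1})"
    unfolding of_nat_sum by (rule sum.cong) (auto simp: column_array_def)
  moreover have "(\<Sum>j=n - 1..n. int (column_array n u v (n - 1) j)) = int (u (n - 1)) + int (v (n - 1))"
    unfolding set(1) using ne by (simp add: column_array_def)
  ultimately have "0 < kus_phi n (n - 1) m (n - 1) (column_array n u v)"
    using assms(2) unfolding set(2) kus_phi_def Let_def by (simp del: of_nat_sum)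
  then show ?thesis
    using assms(1)
    by (auto simp: kus_f_def Let_def column_array_def set_entry_def fun_eq_iff)
qed

text \<open>With all units in the last column, \<open>0 < u (n - 1)\<close> makes this column the
  only maximiser.\<close>

lemma kus_f_column_array_last:
  assumes "2 \<le> n" "\<And>c. c < n - 1 \<Longrightarrow> u c = 0" "\<And>c. c < n - 1 \<Longrightarrow> v c = 0" "0 < u (n - 1)"
  shows "kus_f n (n - 1) m n (column_array n u v) =
    Some (column_array n (u(n - 1 := u (n - 1) - 1)) (v(n - 1 := Suc (v (n - 1)))))"
proof -
  let ?B = "column_array n u v"
  define S where "S = (\<lambda>p. (\<Sum>j=1..p. ?B j (n - 1)) + (\<Sum>j=p..n - 1. ?B j n))"
  have S: "S p = (if p = n - 1 then u (n - 1) else 0) + v (n - 1)" if "p \<in> {1..n - 1}" for p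
  proof -
    have "sum u {1..p} = (\<Sum>j=1..p. if j = n - 1 then u (n - 1) else 0)"
      using that assms by (intro sum.cong) auto
    moreover have "sum v {p..n - 1} = (\<Sum>j=p..n - 1. if j = n - 1 then v (n - 1) else 0)"
      using that assms by (intro sum.cong) auto
    ultimately show ?thesis
      using that sum_column_array[OF assms(1), of 1 p] sum_column_array[OF assms(1), of p "n - 1"]
      unfolding S_def by (auto simp del: One_nat_def)
  qed
  have "Max (S ` {1..n - 1}) = u (n - 1) + v (n - 1)"
  proof (rule Max_eqI)
    show "y \<le> u (n - 1) + v (n - 1)" if "y \<in> S ` {1..n - 1}" for y
      using that S by (auto simp del: One_nat_def)
    have "S (n - 1) = u (n - 1) + v (n - 1)" "n - 1 \<in> {1..n - 1}"
      using S[of "n - 1"] assms(1) by (simp_all del: One_nat_def)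
    then show "u (n - 1) + v (n - 1) \<in> S ` {1..n - 1}" by (metis (no_types, lifting) imageI)
  qed simp
  then have "kus_place n (n - 1) n ?B = {p \<in> {1..n - 1}. S p = u (n - 1) + v (n - 1)}"
    using assms(1) by (simp add: kus_place_def S_def Let_def)
  also have "\<dots> = {n - 1}" using assms(1,4) S by (auto simp del: One_nat_def split: if_splits)
  finally have "kus_place n (n - 1) n ?B = {n - 1}" .
  moreover have nn: "(n < n - 1) = False" "(n = n - 1) = False" using assms(1) by auto
  ultimately have p: "kus_f_place n (n - 1) n ?B = n - 1"
    by (simp only: kus_f_place_def if_False Min_singleton)
  have "(\<Sum>j=1..n - 1. int (?B j (n - 1))) = int (u (n - 1))"
  proof -
    have "(\<Sum>j=1..n - 1. int (?B j (n - 1))) = (\<Sum>j=1..n - 1. if j = n - 1 then int (u (n - 1)) else 0)"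
      using assms by (intro sum.cong) (auto simp: column_array_def)
    moreover have "1 \<le> n - 1" using assms(1) by simp
    ultimately show ?thesis by simp
  qed
  moreover have "(\<Sum>j=1..<n - 1. int (?B j n)) = 0"
    using assms by (intro sum.neutral) (auto simp: column_array_def)
  ultimately have "kus_phi n (n - 1) m n ?B = int (u (n - 1))"
    by (simp only: kus_phi_def p Let_def nn if_False diff_zero)
  then have "\<not> kus_phi n (n - 1) m n ?B \<le> 0" using assms(4) by simp
  then show ?thesis
    unfolding kus_f_def p Let_def nn if_False
    using assms(1) by (auto simp: column_array_def set_entry_def fun_eq_iff)
qed

text \<open>The candidates are rows \<open>n - 1\<close> and \<open>n\<close>, and their sums differ
  only in \<open>u (Suc j)\<close> against \<open>v j\<close>. A tie goes to row \<open>n\<close>,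
  since the largest maximiser is taken.\<close>

lemma kus_f_place_column_array:
  assumes "1 \<le> j" "j < n - 1"
  shows "kus_f_place n (n - 1) j (column_array n u v) = (if v j < u (Suc j) then n - 1 else n)"
    "kus_phi n (n - 1) m j (column_array n u v) =
      (if v j < u (Suc j) then int (u (Suc j)) + int (v (Suc j)) - int (v j) else int (v (Suc j)))"
proof -
  let ?B = "column_array n u v"
  define S where "S = (\<lambda>p. (\<Sum>q=n - 1..p. ?B j q) + (\<Sum>q=p..n. ?B (j + 1) q))"
  have ne: "n - 1 \<noteq> n" using assms by auto
  have set: "{n - 1..n} = {n - 1, n}" using assms by auto
  have S: "S (n - 1) = u j + u (Suc j) + v (Suc j)" "S n = u j + v j + v (Suc j)"
    unfolding S_def set using assms ne by (simp_all add: column_array_def)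
  have "kus_place n (n - 1) j ?B = {p \<in> {n - 1..n}. S p = Max (S ` {n - 1..n})}"
    using assms(2) by (simp add: kus_place_def S_def Let_def)
  also have "\<dots> = (if v j < u (Suc j) then {n - 1} else if v j = u (Suc j) then {n - 1, n} else {n})"
    unfolding set using S ne by (auto simp del: One_nat_def)
  finally show pl: "kus_f_place n (n - 1) j ?B = (if v j < u (Suc j) then n - 1 else n)"
    using assms by (simp add: kus_f_place_def)
  have "{n - 1 + 1..n} = {n}" using assms by auto
  then show "kus_phi n (n - 1) m j ?B =
      (if v j < u (Suc j) then int (u (Suc j)) + int (v (Suc j)) - int (v j) else int (v (Suc j)))"
    unfolding kus_phi_def pl Let_def using assms set ne by (simp add: column_array_def)
qed

lemma kus_f_column_array_lower:
  assumes "1 \<le> j" "j < n - 1" "v j < u (Suc j)"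
  shows "kus_f n (n - 1) m j (column_array n u v) =
    Some (column_array n (u(j := Suc (u j), Suc j := u (Suc j) - 1)) v)"
  using assms kus_f_place_column_array[OF assms(1,2), where u = u and v = v]
  by (auto simp: kus_f_def Let_def column_array_def set_entry_def fun_eq_iff)

lemma kus_f_column_array_upper:
  assumes "1 \<le> j" "j < n - 1" "u (Suc j) \<le> v j" "0 < v (Suc j)"
  shows "kus_f n (n - 1) m j (column_array n u v) =
    Some (column_array n u (v(j := Suc (v j), Suc j := v (Suc j) - 1)))"
  using assms kus_f_place_column_array[OF assms(1,2), where u = u and v = v]
  by (auto simp: kus_f_def Let_def column_array_def set_entry_def fun_eq_iff)

section \<open>Intermediate arrays inside the polytope\<close>

context kus_array
begin

text \<open>A path that rises before column \<open>l\<close> is compared with the same path in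
  \<open>A\<close>, any other path with the one that rises in column \<open>l\<close>.\<close>

lemma column_array_partial:
  assumes l: "1 \<le> l" "l \<le> n - 1"
    and u: "\<And>c. c < l \<Longrightarrow> u c = A c (n - 1)" and v: "\<And>c. c < l \<Longrightarrow> v c = A c n"
    and su: "sum u {l..n - 1} \<le> A l (n - 1)" and sv: "sum v {l..n - 1} \<le> (\<Sum>c=l..n - 1. A c n)"
  shows "column_array n u v \<in> kus_arrays n (n - 1) m"
  unfolding column_array_kus_arrays_iff[OF n2]
proof
  fix r assume "r \<in> {1..n - 1}"
  then have r: "1 \<le> r" "r \<le> n - 1" by auto
  show "sum u {1..r} + sum v {r..n - 1} \<le> m"
  proof (cases "r < l")
    case True
    have set: "{r..n - 1} = {r..<l} \<union> {l..n - 1}" using True l by auto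
    have "sum v {r..n - 1} = sum v {r..<l} + sum v {l..n - 1}"
      unfolding set by (rule sum.union_disjoint) auto
    moreover have "(\<Sum>c=r..n - 1. A c n) = (\<Sum>c=r..<l. A c n) + (\<Sum>c=l..n - 1. A c n)"
      unfolding set by (rule sum.union_disjoint) auto
    moreover have "sum u {1..r} = (\<Sum>c=1..r. A c (n - 1))" using u True by (intro sum.cong) auto
    moreover have "sum v {r..<l} = (\<Sum>c=r..<l. A c n)" using v by (intro sum.cong) auto
    ultimately show ?thesis using path_bound[OF r] sv by linarith
  next
    case False
    have "sum u {1..r} \<le> sum u ({1..<l} \<union> {l..n - 1})"
      using r by (intro sum_mono2) auto
    also have "\<dots> = sum u {1..<l} + sum u {l..n - 1}" by (rule sum.union_disjoint) auto
    also have "sum u {1..<l} = (\<Sum>c=1..<l. A c (n - 1))" using u by (intro sum.cong) auto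
    also have "(\<Sum>c=1..<l. A c (n - 1)) + sum u {l..n - 1} \<le>
        (\<Sum>c=1..<l. A c (n - 1)) + A l (n - 1)" using su by simp
    also have "\<dots> = (\<Sum>c=1..l. A c (n - 1))"
      using l by (simp add: sum.last_plus)
    finally have "sum u {1..r} \<le> (\<Sum>c=1..l. A c (n - 1))" .
    moreover have "sum v {r..n - 1} \<le> sum v {l..n - 1}"
      using False by (intro sum_mono2) auto
    ultimately show ?thesis using path_bound[OF l] sv by linarith
  qed
qed

definition "rest l = (\<Sum>p=l..n - 1. A p n)"

lemma rest_Suc: "l \<le> n - 1 \<Longrightarrow> rest l = A l n + rest (Suc l)"
  by (simp add: rest_def sum.atLeast_Suc_atMost)

text \<open>The stage before column \<open>l\<close> is carried to its place: \<open>x\<close> units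
  of its lower entry have been created in the last column, where \<open>init_v\<close> stores the
  upper entries of all unfinished columns.\<close>

definition init_u :: "nat \<Rightarrow> nat \<Rightarrow> nat \<Rightarrow> nat" where
  "init_u l x c = (if c < l then A c (n - 1) else if c = n - 1 then x else 0)"

definition init_v :: "nat \<Rightarrow> nat \<Rightarrow> nat" where
  "init_v l c = (if c < l then A c n else if c = n - 1 then rest l else 0)"

text \<open>Column \<open>l\<close> of \<open>A\<close> on its way from column \<open>Suc j\<close> to column \<open>j\<close>; the last column also
  stores the upper entries of the columns still to be treated.\<close>

definition move_u :: "nat \<Rightarrow> nat \<Rightarrow> nat \<Rightarrow> nat \<Rightarrow> nat" where
  "move_u l j x c = (if c < l then A c (n - 1)
     else if c = j then x else if c = Suc j then A l (n - 1) - x else 0)"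

definition move_v :: "nat \<Rightarrow> nat \<Rightarrow> nat \<Rightarrow> nat \<Rightarrow> nat" where
  "move_v l j y c = (if c < l then A c n
     else (if c = j then y else if c = Suc j then A l n - y else 0) +
       (if c = n - 1 then rest (Suc l) else 0))"

lemma init_in:
  assumes "1 \<le> l" "l \<le> n - 1" "x \<le> A l (n - 1)"
  shows "column_array n (init_u l x) (init_v l) \<in> kus_arrays n (n - 1) m"
proof (rule column_array_partial[OF assms(1,2)])
  have "sum (init_u l x) {l..n - 1} = (\<Sum>c=l..n - 1. if c = n - 1 then x else 0)"
    by (intro sum.cong) (auto simp: init_u_def)
  then show "sum (init_u l x) {l..n - 1} \<le> A l (n - 1)" using assms by simp
  have "sum (init_v l) {l..n - 1} = (\<Sum>c=l..n - 1. if c = n - 1 then rest l else 0)"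
    by (intro sum.cong) (auto simp: init_v_def)
  then show "sum (init_v l) {l..n - 1} \<le> (\<Sum>c=l..n - 1. A c n)" using assms by (simp add: rest_def)
qed (auto simp: init_u_def init_v_def)

lemma move_in:
  assumes "1 \<le> l" "l \<le> j" "j < n - 1" "x \<le> A l (n - 1)" "y \<le> A l n"
  shows "column_array n (move_u l j x) (move_v l j y) \<in> kus_arrays n (n - 1) m"
proof (rule column_array_partial)
  have "sum (move_u l j x) {l..n - 1} = (\<Sum>c=l..n - 1. (if c = j then x else 0) +
      (if c = Suc j then A l (n - 1) - x else 0))"
    by (intro sum.cong) (auto simp: move_u_def)
  then show "sum (move_u l j x) {l..n - 1} \<le> A l (n - 1)"
    using assms by (simp add: sum.distrib)
  have "sum (move_v l j y) {l..n - 1} = (\<Sum>c=l..n - 1. (if c = j then y else 0) +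
      (if c = Suc j then A l n - y else 0) + (if c = n - 1 then rest (Suc l) else 0))"
    by (intro sum.cong) (auto simp: move_v_def)
  also have "\<dots> = rest l"
    using assms by (simp add: sum.distrib rest_Suc)
  finally show "sum (move_v l j y) {l..n - 1} \<le> (\<Sum>c=l..n - 1. A c n)" by (simp add: rest_def)
qed (use assms in \<open>auto simp: move_u_def move_v_def\<close>)

section \<open>The word of operators carried through the isomorphism\<close>

lemma tab_f_pow_crystal_iso:
  assumes "crystal_iso n (n - 1) m \<phi>" "1 \<le> j" "j \<le> n"
    and "\<And>e. e < c \<Longrightarrow> X e \<in> kus_arrays n (n - 1) m"
    and "\<And>e. e < c \<Longrightarrow> kus_f n (n - 1) m j (X e) = Some (X (Suc e))"
  shows "tab_f_pow (n - 1) m j c (Some (\<phi> (X 0))) = Some (\<phi> (X c))"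
proof (rule tab_f_pow_chain[where X = "\<lambda>e. \<phi> (X e)"])
  fix e assume "e < c"
  then have "map_option \<phi> (kus_f n (n - 1) m j (X e)) = tab_f (n - 1) m j (\<phi> (X e))"
    using assms(1-3) assms(4)[OF \<open>e < c\<close>] unfolding crystal_iso_def by simp
  then show "tab_f (n - 1) m j (\<phi> (X e)) = Some (\<phi> (X (Suc e)))"
    using assms(5)[OF \<open>e < c\<close>] by simp
qed

context
  fixes \<phi> assumes iso: "crystal_iso n (n - 1) m \<phi>"
begin

lemma f_pow_init:
  assumes "1 \<le> l" "l \<le> n - 1"
  shows "tab_f_pow (n - 1) m (n - 1) (A l (n - 1)) (Some (\<phi> (column_array n (init_u l 0) (init_v l)))) =
    Some (\<phi> (column_array n (init_u l (A l (n - 1))) (init_v l)))"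
proof (rule tab_f_pow_crystal_iso[OF iso, where X = "\<lambda>x. column_array n (init_u l x) (init_v l)"])
  fix x assume x: "x < A l (n - 1)"
  then show "column_array n (init_u l x) (init_v l) \<in> kus_arrays n (n - 1) m"
    using init_in assms by simp
  \<comment> \<open>The next array lies in the polytope and has one more unit on the path that rises
    in the last column; this gives the strict inequality needed for the present one.\<close>
  have "column_array n (init_u l (Suc x)) (init_v l) \<in> kus_arrays n (n - 1) m"
    using init_in assms x by simp
  then have "sum (init_u l (Suc x)) {1..n - 1} + init_v l (n - 1) \<le> m"
    unfolding column_array_kus_arrays_iff[OF n2] using n2 by (auto dest: bspec[of _ _ "n - 1"])
  moreover have "sum (init_u l (Suc x)) {1..n - 1} = Suc (sum (init_u l x) {1..n - 1})"
  proof -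
    have "{1..n - 1} = insert (n - 1) {1..<n - 1}" using n2 by auto
    moreover have "sum (init_u l (Suc x)) {1..<n - 1} = sum (init_u l x) {1..<n - 1}"
      by (intro sum.cong) (auto simp: init_u_def)
    ultimately show ?thesis using assms by (simp add: init_u_def)
  qed
  ultimately have "sum (init_u l x) {1..n - 1} + init_v l (n - 1) < m" by simp
  then have "kus_f n (n - 1) m (n - 1) (column_array n (init_u l x) (init_v l)) =
      Some (column_array n ((init_u l x)(n - 1 := Suc (init_u l x (n - 1)))) (init_v l))"
    by (rule kus_f_column_array_middle[OF n2])
  moreover have "(init_u l x)(n - 1 := Suc (init_u l x (n - 1))) = init_u l (Suc x)"
    using assms by (auto simp: init_u_def fun_eq_iff)
  ultimately show "kus_f n (n - 1) m (n - 1) (column_array n (init_u l x) (init_v l)) =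
      Some (column_array n (init_u l (Suc x)) (init_v l))" by simp
qed (use n2 in auto)

text \<open>The upper entry of column \<open>j\<close> is 0 at first, so the lower units move as
  long as any remain in column \<open>Suc j\<close>. Once that entry is 0, the rule selects row
  \<open>n\<close> and the upper units follow.\<close>

lemma f_pow_move:
  assumes l: "1 \<le> l" "l \<le> j" "j < n - 1"
  shows "tab_f_pow (n - 1) m j (A l (n - 1) + A l n)
      (Some (\<phi> (column_array n (move_u l j 0) (move_v l j 0)))) =
    Some (\<phi> (column_array n (move_u l j (A l (n - 1))) (move_v l j (A l n))))"
proof -
  have "tab_f_pow (n - 1) m j (A l (n - 1)) (Some (\<phi> (column_array n (move_u l j 0) (move_v l j 0)))) =
      Some (\<phi> (column_array n (move_u l j (A l (n - 1))) (move_v l j 0)))"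
  proof (rule tab_f_pow_crystal_iso[OF iso, where X = "\<lambda>x. column_array n (move_u l j x) (move_v l j 0)"])
    fix x assume x: "x < A l (n - 1)"
    then show "column_array n (move_u l j x) (move_v l j 0) \<in> kus_arrays n (n - 1) m"
      using move_in assms by simp
    have "move_v l j 0 j < move_u l j x (Suc j)"
      using l x by (simp add: move_u_def move_v_def)
    moreover have "(move_u l j x)(j := Suc (move_u l j x j), Suc j := move_u l j x (Suc j) - 1) =
        move_u l j (Suc x)"
      using l by (auto simp: move_u_def fun_eq_iff)
    ultimately show "kus_f n (n - 1) m j (column_array n (move_u l j x) (move_v l j 0)) =
        Some (column_array n (move_u l j (Suc x)) (move_v l j 0))"
      using kus_f_column_array_lower[of j n "move_v l j 0" "move_u l j x" m] l by simp
  qed (use l in auto)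
  moreover have "tab_f_pow (n - 1) m j (A l n)
      (Some (\<phi> (column_array n (move_u l j (A l (n - 1))) (move_v l j 0)))) =
      Some (\<phi> (column_array n (move_u l j (A l (n - 1))) (move_v l j (A l n))))"
  proof (rule tab_f_pow_crystal_iso[OF iso, where X = "\<lambda>y. column_array n (move_u l j (A l (n - 1))) (move_v l j y)"])
    fix y assume y: "y < A l n"
    let ?u = "move_u l j (A l (n - 1))"
    show "column_array n ?u (move_v l j y) \<in> kus_arrays n (n - 1) m"
      using move_in assms y by simp
    have "?u (Suc j) \<le> move_v l j y j" "0 < move_v l j y (Suc j)"
      using l y by (simp_all add: move_u_def move_v_def)
    moreover have "(move_v l j y)(j := Suc (move_v l j y j), Suc j := move_v l j y (Suc j) - 1) =
        move_v l j (Suc y)"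
      using l y by (auto simp: move_v_def fun_eq_iff)
    ultimately show "kus_f n (n - 1) m j (column_array n ?u (move_v l j y)) =
        Some (column_array n ?u (move_v l j (Suc y)))"
      using kus_f_column_array_upper[of j n ?u "move_v l j y" m] l by simp
  qed (use l in auto)
  ultimately show ?thesis by (simp add: tab_f_pow_add)
qed

lemma Y_op_init:
  assumes l: "1 \<le> l" "l \<le> n - 1"
  shows "Y_op n m A l (Some (\<phi> (column_array n (init_u l 0) (init_v l)))) =
    Some (\<phi> (column_array n (init_u (Suc l) 0) (init_v (Suc l))))"
proof (cases "l = n - 1")
  case True
  have "column_array n (init_u l (A l (n - 1))) (init_v l) =
      column_array n (init_u (Suc l) 0) (init_v (Suc l))"
    using True by (intro column_array_cong) (auto simp: init_u_def init_v_def rest_def)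
  then show ?thesis using f_pow_init[OF l] True by (simp add: Y_op_def)
next
  case False
  \<comment> \<open>The last column is \<open>Suc (n - 2)\<close>, and \<open>rest l\<close> splits
    into the upper entry about to move and the stock left behind.\<close>
  have start: "column_array n (init_u l (A l (n - 1))) (init_v l) =
      column_array n (move_u l (n - 2) 0) (move_v l (n - 2) 0)"
    using l False rest_Suc[of l]
    by (intro column_array_cong) (auto simp: init_u_def init_v_def move_u_def move_v_def)
  have "foldr (\<lambda>j. tab_f_pow (n - 1) m j (A l (n - 1) + A l n)) [t..<n - 1]
      (Some (\<phi> (column_array n (move_u l (n - 2) 0) (move_v l (n - 2) 0)))) =
      Some (\<phi> (column_array n (move_u l t (A l (n - 1))) (move_v l t (A l n))))"
    if "l \<le> t" "t \<le> n - 2" for t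
    using that(2,1)
  proof (induction t rule: inc_induct)
    case base
    have "[n - 2..<n - 1] = [n - 2]" using n2 by (simp add: upt_conv_Cons)
    then show ?case using f_pow_move[of l "n - 2"] base l False by simp
  next
    case (step t)
    \<comment> \<open>Arrival in column \<open>Suc t\<close> is departure for column
      \<open>t\<close>.\<close>
    have "column_array n (move_u l (Suc t) (A l (n - 1))) (move_v l (Suc t) (A l n)) =
        column_array n (move_u l t 0) (move_v l t 0)"
      using step by (intro column_array_cong) (auto simp: move_u_def move_v_def)
    moreover have "[t..<n - 1] = t # [Suc t..<n - 1]"
      using step.hyps by (intro upt_conv_Cons) simp
    moreover have "l \<le> Suc t" "t < n - 1" using step by auto
    ultimately show ?case using step.IH f_pow_move[OF l(1) step.prems] by simp
  qed
  note this[of l]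
  moreover have "column_array n (move_u l l (A l (n - 1))) (move_v l l (A l n)) =
      column_array n (init_u (Suc l) 0) (init_v (Suc l))"
    using l False by (intro column_array_cong) (auto simp: move_u_def move_v_def init_u_def init_v_def less_Suc_eq)
  ultimately show ?thesis
    using f_pow_init[OF l] start l False by (simp add: Y_op_def)
qed

lemma H_op_init:
  "H_op n m A (Some (highest_tableau (n - 1) m)) = Some (\<phi> (column_array n (init_u 1 0) (init_v 1)))"
proof -
  let ?S = "rest 1"
  define w where "w x c = (if c = n - 1 then x else 0)" for x c :: nat
  have S: "?S \<le> m" using path_bound[of 1] n2 unfolding rest_def by linarith
  have w_in: "column_array n (w x) (w y) \<in> kus_arrays n (n - 1) m" if "x + y \<le> ?S" for x y
    unfolding column_array_kus_arrays_iff[OF n2]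
  proof
    fix r assume "r \<in> {1..n - 1}"
    then have "sum (w x) {1..r} \<le> x" "sum (w y) {r..n - 1} \<le> y" by (simp_all add: w_def)
    then show "sum (w x) {1..r} + sum (w y) {r..n - 1} \<le> m" using that S by linarith
  qed
  have "column_array n (w 0) (w 0) = zero_array"
    by (auto simp: column_array_def w_def zero_array_def fun_eq_iff)
  then have zero: "\<phi> (column_array n (w 0) (w 0)) = highest_tableau (n - 1) m"
    using iso by (simp add: crystal_iso_def)
  have "tab_f_pow (n - 1) m (n - 1) ?S (Some (\<phi> (column_array n (w 0) (w 0)))) =
      Some (\<phi> (column_array n (w ?S) (w 0)))"
  proof (rule tab_f_pow_crystal_iso[OF iso, where X = "\<lambda>x. column_array n (w x) (w 0)"])
    fix x assume x: "x < ?S"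
    then show "column_array n (w x) (w 0) \<in> kus_arrays n (n - 1) m" using w_in by simp
    have "sum (w x) {1..n - 1} + w 0 (n - 1) < m" using x S n2 by (simp add: w_def)
    moreover have "(w x)(n - 1 := Suc (w x (n - 1))) = w (Suc x)" by (auto simp: w_def)
    ultimately show "kus_f n (n - 1) m (n - 1) (column_array n (w x) (w 0)) =
        Some (column_array n (w (Suc x)) (w 0))"
      using kus_f_column_array_middle[OF n2, of "w x" "w 0" m] by simp
  qed (use n2 in auto)
  \<comment> \<open>The differences \<open>?S - 0\<close> and \<open>?S - ?S\<close> match the
    family in which \<open>x\<close> of the \<open>?S\<close> units have changed rows.\<close>
  moreover have "tab_f_pow (n - 1) m n ?S (Some (\<phi> (column_array n (w (?S - 0)) (w 0)))) =
      Some (\<phi> (column_array n (w (?S - ?S)) (w ?S)))"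
  proof (rule tab_f_pow_crystal_iso[OF iso, where X = "\<lambda>x. column_array n (w (?S - x)) (w x)"])
    fix x assume x: "x < ?S"
    then show "column_array n (w (?S - x)) (w x) \<in> kus_arrays n (n - 1) m" using w_in by simp
    have "(w (?S - x))(n - 1 := w (?S - x) (n - 1) - 1) = w (?S - Suc x)"
      "(w x)(n - 1 := Suc (w x (n - 1))) = w (Suc x)" by (auto simp: w_def)
    then show "kus_f n (n - 1) m n (column_array n (w (?S - x)) (w x)) =
        Some (column_array n (w (?S - Suc x)) (w (Suc x)))"
      using kus_f_column_array_last[OF n2, of "w (?S - x)" "w x" m] x by (simp add: w_def)
  qed (use n2 in auto)
  moreover have "column_array n (w 0) (w ?S) = column_array n (init_u 1 0) (init_v 1)"
    by (intro column_array_cong) (auto simp: w_def init_u_def init_v_def)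
  ultimately show ?thesis by (simp add: H_op_def zero rest_def)
qed

lemma T_tab_crystal_iso: "T_tab n m A (n - 1) = Some (\<phi> A)"
proof -
  have "T_tab n m A k = Some (\<phi> (column_array n (init_u (Suc k) 0) (init_v (Suc k))))"
    if "k \<le> n - 1" for k
    using that
  proof (induction k)
    case 0
    then show ?case using H_op_init by (simp add: T_tab_def)
  next
    case (Suc k)
    then show ?case using Y_op_init[of "Suc k"] by (simp add: T_tab_def)
  qed
  \<comment> \<open>At index \<open>n = Suc (n - 1)\<close> every column is finished.\<close>
  moreover have "column_array n (init_u n 0) (init_v n) p q = A p q" for p q
  proof (cases "1 \<le> p \<and> p \<le> n - 1 \<and> (q = n - 1 \<or> q = n)")
    case True
    then show ?thesis by (auto simp: column_array_def init_u_def init_v_def)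
  next
    case False
    then have "\<not> (1 \<le> p \<and> p \<le> n - 1 \<and> n - 1 \<le> q \<and> q \<le> n)" by auto
    then show ?thesis using A_outside False by (auto simp: column_array_def)
  qed
  then have "column_array n (init_u n 0) (init_v n) = A" by blast
  ultimately show ?thesis using n2 by simp
qed

end

end

theorem theorem4p5:
  fixes n i m :: nat and A :: array and a :: "nat \<Rightarrow> nat \<Rightarrow> int" and \<Omega> \<nu> :: "nat \<Rightarrow> int"
  assumes "n \<ge> 4" and "i = n - 1" and "m \<ge> 1" and "A \<in> kus_arrays n i m"
  defines "a \<equiv> \<lambda>p q. int (A p q)" and "\<Omega> \<equiv> Omega n A" and "\<nu> \<equiv> nu n A"
  shows "(\<forall>k\<in>{1..n - 1}. \<exists>T. T_tab n m A k = Some T \<and> T \<in> ssyt n i m \<and>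
      (\<forall>s. 1 \<le> s \<and> s \<le> k - 1 \<longrightarrow>
         int (tab_matrix m T s 1) = int m - (\<Sum>j=1..s. a j n - \<nu> j * \<Omega> j) \<and>
         int (tab_matrix m T s 2) = - (\<Sum>j=1..s. \<nu> j * \<Omega> j) + (1 - \<nu> (s + 1)) * \<Omega> (s + 1) \<and>
         int (tab_matrix m T s 3) = (\<Sum>j=2..s + 1. a j (n - 1) + \<nu> j * \<Omega> j)) \<and>
      (\<forall>s. k \<le> s \<and> s \<le> i - 1 \<longrightarrow>
         int (tab_matrix m T s 1) = int m - (\<Sum>j=1..k. a j n - \<nu> j * \<Omega> j) \<and>
         int (tab_matrix m T s 2) = - (\<Sum>j=1..k. \<nu> j * \<Omega> j) + a k n + (1 - \<nu> k) * \<Omega> k \<and>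
         int (tab_matrix m T s 3) = (\<Sum>j=2..k. a j (n - 1) + \<nu> j * \<Omega> j)) \<and>
      int (tab_matrix m T i 1) = int m - (\<Sum>j=1..i. a j n) + (\<Sum>j=1..k. \<nu> j * \<Omega> j) \<and>
      int (tab_matrix m T i 2) = - (\<Sum>j=1..k. \<nu> j * \<Omega> j) \<and>
      int (tab_matrix m T i 3) = (\<Sum>j=1..i. a j n))
    \<and> (\<forall>\<phi>. crystal_iso n i m \<phi> \<longrightarrow> T_tab n m A (n - 1) = Some (\<phi> A))"
proof -
  interpret kus_array n m A
    using assms(1,2,4) by unfold_locales auto
  let ?mat = "\<lambda>k. tab_matrix m (state k n)"
  have mat: "int (?mat k s 1) = state_p k n s" "int (?mat k s 2) = state_q k n s - state_p k n s"
      "int (?mat k s 3) = int m - state_q k n s"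
    if "k \<le> n - 1" "1 \<le> s" "s \<le> n - 1" for k s
    using tab_matrix_profile_tableau[OF T_tab_state(2)] that by auto
  have p: "prow s = int m - (\<Sum>j=1..s. a j n - \<nu> j * \<Omega> j)" for s
    by (simp add: prow_def a_def \<nu>_def \<Omega>_def)
  have q: "int m - qrow s = (\<Sum>j=2..s. a j (n - 1) + \<nu> j * \<Omega> j)" for s
    by (simp add: qrow_def a_def \<nu>_def \<Omega>_def)
  have id: "idle s = (\<Sum>j=1..s. \<nu> j * \<Omega> j)" for s
    by (simp add: idle_def \<nu>_def \<Omega>_def)
  have qp: "qrow s - prow s = - (\<Sum>j=1..s. \<nu> j * \<Omega> j) + a s n + (1 - \<nu> s) * \<Omega> s" for s
    using qrow_minus_prow[of s] nu_Omega(2)[of s] id[of s] by (simp add: a_def \<nu>_def \<Omega>_def)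
  \<comment> \<open>Rows before \<open>k\<close> pair \<open>qrow (Suc s)\<close> with
    \<open>prow s\<close>, because \<open>q\<close> is one index ahead.\<close>
  have qp': "qrow (Suc s) - prow s = - (\<Sum>j=1..s. \<nu> j * \<Omega> j) + (1 - \<nu> (s + 1)) * \<Omega> (s + 1)" for s
  proof -
    have "min 0 (Omega n A (Suc s)) + max 0 (Omega n A (Suc s)) = Omega n A (Suc s)" by simp
    then have "qrow (Suc s) - prow s = - idle s + max 0 (Omega n A (Suc s))"
      using qrow_minus_prow[of s] Omega_Suc[of s] qrow_simps(2)[of s] by (simp add: drop_q_def)
    then show ?thesis by (simp add: id nu_Omega \<nu>_def \<Omega>_def)
  qed
  have tot: "upper_total = (\<Sum>j=1..n - 1. a j n)" by (simp add: upper_total_def a_def)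
  show ?thesis
  proof (intro conjI ballI)
    fix k assume "k \<in> {1..n - 1}"
    then have k: "1 \<le> k" "k \<le> n - 1" by auto
    have row1: "state_p k n s = prow s" "state_q k n s = qrow (s + 1)"
      if "1 \<le> s" "s \<le> k - 1" for s
      using that k by (auto simp: state_p_def state_q_def)
    have row2: "state_p k n s = prow k" "state_q k n s = qrow k" if "k \<le> s" "s \<le> n - 1 - 1" for s
      using that k by (auto simp: state_p_def state_q_def)
    \<comment> \<open>For \<open>k = n - 1\<close> the clause with \<open>prow\<close> governs the
      last row; \<open>prow_eq\<close> gives the same value.\<close>
    have row3: "state_p k n (n - 1) = int m - upper_total + idle k"
        "state_q k n (n - 1) = int m - upper_total"
      using k n2 prow_eq[of "n - 1"] by (auto simp: state_p_def state_q_def upper_total_def)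
    show "\<exists>T. T_tab n m A k = Some T \<and> T \<in> ssyt n i m \<and>
      (\<forall>s. 1 \<le> s \<and> s \<le> k - 1 \<longrightarrow>
         int (tab_matrix m T s 1) = int m - (\<Sum>j=1..s. a j n - \<nu> j * \<Omega> j) \<and>
         int (tab_matrix m T s 2) = - (\<Sum>j=1..s. \<nu> j * \<Omega> j) + (1 - \<nu> (s + 1)) * \<Omega> (s + 1) \<and>
         int (tab_matrix m T s 3) = (\<Sum>j=2..s + 1. a j (n - 1) + \<nu> j * \<Omega> j)) \<and>
      (\<forall>s. k \<le> s \<and> s \<le> i - 1 \<longrightarrow>
         int (tab_matrix m T s 1) = int m - (\<Sum>j=1..k. a j n - \<nu> j * \<Omega> j) \<and>
         int (tab_matrix m T s 2) = - (\<Sum>j=1..k. \<nu> j * \<Omega> j) + a k n + (1 - \<nu> k) * \<Omega> k \<and>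
         int (tab_matrix m T s 3) = (\<Sum>j=2..k. a j (n - 1) + \<nu> j * \<Omega> j)) \<and>
      int (tab_matrix m T i 1) = int m - (\<Sum>j=1..i. a j n) + (\<Sum>j=1..k. \<nu> j * \<Omega> j) \<and>
      int (tab_matrix m T i 2) = - (\<Sum>j=1..k. \<nu> j * \<Omega> j) \<and>
      int (tab_matrix m T i 3) = (\<Sum>j=1..i. a j n)"
    proof (rule exI[of _ "state k n"], unfold \<open>i = n - 1\<close>, intro conjI allI impI)
      show "T_tab n m A k = Some (state k n)" "state k n \<in> ssyt n (n - 1) m"
        using T_tab_state[OF k(2)] profile_tableau_ssyt n2 by auto
    next
      fix s assume s: "1 \<le> s \<and> s \<le> k - 1"
      then have b: "1 \<le> s" "s \<le> n - 1" using k by auto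
      note r = mat[OF k(2) b, unfolded row1[OF conjunct1[OF s] conjunct2[OF s]]]
      show "int (?mat k s 1) = int m - (\<Sum>j=1..s. a j n - \<nu> j * \<Omega> j)"
        using r(1) p by simp
      show "int (?mat k s 2) = - (\<Sum>j=1..s. \<nu> j * \<Omega> j) + (1 - \<nu> (s + 1)) * \<Omega> (s + 1)"
        using r(2) qp' by simp
      show "int (?mat k s 3) = (\<Sum>j=2..s + 1. a j (n - 1) + \<nu> j * \<Omega> j)"
        using r(3) unfolding q .
    next
      fix s assume s: "k \<le> s \<and> s \<le> n - 1 - 1"
      then have b: "1 \<le> s" "s \<le> n - 1" using k by auto
      note r = mat[OF k(2) b, unfolded row2[OF conjunct1[OF s] conjunct2[OF s]]]
      show "int (?mat k s 1) = int m - (\<Sum>j=1..k. a j n - \<nu> j * \<Omega> j)"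
        using r(1) unfolding p .
      show "int (?mat k s 2) = - (\<Sum>j=1..k. \<nu> j * \<Omega> j) + a k n + (1 - \<nu> k) * \<Omega> k"
        using r(2) unfolding qp .
      show "int (?mat k s 3) = (\<Sum>j=2..k. a j (n - 1) + \<nu> j * \<Omega> j)"
        using r(3) unfolding q .
    next
      have b: "1 \<le> n - 1" "n - 1 \<le> n - 1" using n2 by auto
      note r = mat[OF k(2) b, unfolded row3 tot id]
      show "int (?mat k (n - 1) 1) = int m - (\<Sum>j=1..n - 1. a j n) + (\<Sum>j=1..k. \<nu> j * \<Omega> j)"
        using r(1) .
      show "int (?mat k (n - 1) 2) = - (\<Sum>j=1..k. \<nu> j * \<Omega> j)"
        using r(2) by simp
      show "int (?mat k (n - 1) 3) = (\<Sum>j=1..n - 1. a j n)"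
        using r(3) by simp
    qed
  next
    show "\<forall>\<phi>. crystal_iso n i m \<phi> \<longrightarrow> T_tab n m A (n - 1) = Some (\<phi> A)"
      using T_tab_crystal_iso \<open>i = n - 1\<close> by simp
  qed
qed

end
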